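(* Let $p=n^{\delta-1}$ with $0<\delta<1$ fixed. Then for every $k$ there is an explicitly described algorithm, running in time $n^{O(1/(1-\delta))}$, such that for every adversarial planting strategy, when $G\sim AG(n,p,k)$ is generated with that strategy, the algorithm outputs a maximum clique of $G$ with probability tending to $1$ as $n\to\infty$ (over the choice of $G'\sim G(n,p)$).
   Context: $G(n,p)$ is the Erdős–Rényi random graph on $n$ vertices with edge probability $p$. The model $AG(n,p,k)$: sample $G'\sim G(n,p)$; a computationally unbounded adversary, as an arbitrary function of $G'$ (its strategy), selects a set $K$ of $k$ vertices; all missing edges inside $K$ are added, giving $G$. *)

theory Defs
  imports "HOL-Probability.Probability"
begin

text \<open>A graph on vertex set {0..<n} is a set of edges, each edge a 2-element set.\<close>

definition pairs :: "nat \<Rightarrow> nat set set" where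
  "pairs n = {e. \<exists>i j. i < j \<and> j < n \<and> e = {i, j}}"

definition gnp :: "nat \<Rightarrow> real \<Rightarrow> nat set set pmf" where
  "gnp n p = map_pmf (\<lambda>f. {e \<in> pairs n. f e}) (Pi_pmf (pairs n) False (\<lambda>_. bernoulli_pmf p))"

definition plant :: "nat \<Rightarrow> nat set set \<Rightarrow> nat set \<Rightarrow> nat set set" where
  "plant n G K = G \<union> {e \<in> pairs n. e \<subseteq> K}"

definition is_clique :: "nat \<Rightarrow> nat set set \<Rightarrow> nat set \<Rightarrow> bool" where
  "is_clique n G C \<longleftrightarrow> C \<subseteq> {..<n} \<and> (\<forall>x\<in>C. \<forall>y\<in>C. x \<noteq> y \<longrightarrow> {x, y} \<in> G)"

definition is_max_clique :: "nat \<Rightarrow> nat set set \<Rightarrow> nat set \<Rightarrow> bool" where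
  "is_max_clique n G C \<longleftrightarrow> is_clique n G C \<and> (\<forall>D. is_clique n G D \<longrightarrow> card D \<le> card C)"

definition strategy :: "(nat \<Rightarrow> nat) \<Rightarrow> (nat \<Rightarrow> nat set set \<Rightarrow> nat set) \<Rightarrow> bool" where
  "strategy k S \<longleftrightarrow> (\<forall>n G. G \<subseteq> pairs n \<longrightarrow> S n G \<subseteq> {..<n} \<and> card (S n G) = k n)"

text \<open>Registers hold natural numbers; arithmetic is addition and truncated subtraction;
  indirect addressing via Load/Store; Edge queries the adjacency matrix of the input graph;
  Out adds a vertex to the output set. The program halts when pc leaves the program or
  reaches Halt. Running time = number of executed instructions.\<close>

datatype instr =
    Const nat nat
  | Add nat nat nat
  | Sub nat nat nat
  | Load nat nat
  | Store nat nat
  | Edge nat nat nat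
  | Jz nat nat
  | Jmp nat
  | Out nat
  | Halt

type_synonym config = "nat \<times> (nat \<Rightarrow> nat) \<times> nat set"

definition halted :: "instr list \<Rightarrow> config \<Rightarrow> bool" where
  "halted prog c \<longleftrightarrow> fst c \<ge> length prog \<or> prog ! fst c = Halt"

fun exec_instr :: "nat set set \<Rightarrow> instr \<Rightarrow> config \<Rightarrow> config" where
  "exec_instr G (Const r v) (pc, R, Os) = (Suc pc, R(r := v), Os)"
| "exec_instr G (Add r a b) (pc, R, Os) = (Suc pc, R(r := R a + R b), Os)"
| "exec_instr G (Sub r a b) (pc, R, Os) = (Suc pc, R(r := R a - R b), Os)"
| "exec_instr G (Load r a) (pc, R, Os) = (Suc pc, R(r := R (R a)), Os)"
| "exec_instr G (Store a b) (pc, R, Os) = (Suc pc, R(R a := R b), Os)"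
| "exec_instr G (Edge r a b) (pc, R, Os) = (Suc pc, R(r := (if {R a, R b} \<in> G then 1 else 0)), Os)"
| "exec_instr G (Jz a l) (pc, R, Os) = ((if R a = 0 then l else Suc pc), R, Os)"
| "exec_instr G (Jmp l) (pc, R, Os) = (l, R, Os)"
| "exec_instr G (Out a) (pc, R, Os) = (Suc pc, R, insert (R a) Os)"
| "exec_instr G Halt c = c"

definition step :: "instr list \<Rightarrow> nat set set \<Rightarrow> config \<Rightarrow> config" where
  "step prog G c = (if halted prog c then c else exec_instr G (prog ! fst c) c)"

definition steps :: "instr list \<Rightarrow> nat set set \<Rightarrow> nat \<Rightarrow> config \<Rightarrow> config" where
  "steps prog G t = (step prog G ^^ t)"

definition init_config :: "nat \<Rightarrow> nat \<Rightarrow> config" where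
  "init_config n k = (0, (\<lambda>_. 0)(0 := n, 1 := k), {})"

definition halts_within :: "instr list \<Rightarrow> nat set set \<Rightarrow> config \<Rightarrow> nat \<Rightarrow> bool" where
  "halts_within prog G c t \<longleftrightarrow> halted prog (steps prog G t c)"

definition ram_output :: "instr list \<Rightarrow> nat set set \<Rightarrow> config \<Rightarrow> nat set option" where
  "ram_output prog G c =
     (if \<exists>t. halts_within prog G c t
      then Some (snd (snd (steps prog G (LEAST t. halts_within prog G c t) c)))
      else None)"

end

theory Submission
  imports Defs
begin

text \<open>
  Let \<open>a\<close> be the least integer exceeding \<open>2/(1-\<delta>)\<close>. The expected number of copies of
  \<open>K(a,a)\<close> in \<open>G(n,p)\<close> is at most \<open>n^(2a) p^(a^2)\<close>, which tends to \<open>0\<close>; so with high probability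
  \<open>G'\<close> contains none, and in particular no clique of size \<open>2a\<close>. Then, whatever set \<open>K\<close> is
  planted, a maximum clique \<open>D\<close> of \<open>G\<close> is described by \<open>O(a)\<close> vertices. If \<open>|D| \<le> 3a\<close> list
  \<open>D\<close> itself. Otherwise \<open>|D - K| < 2a\<close>, so \<open>D\<close> and \<open>K\<close> share a set \<open>T\<close> of \<open>a\<close> vertices; the
  set \<open>M\<close> of vertices equal or adjacent to each vertex of \<open>T\<close> contains \<open>D\<close> and \<open>K\<close>, and
  \<open>|M - K| < a\<close> because \<open>T\<close> and \<open>M - K\<close> form a biclique of \<open>G'\<close>. As \<open>|D| \<ge> |K|\<close>, also
  \<open>|M - D| < a\<close>, so \<open>D\<close> is \<open>M\<close> minus fewer than \<open>a\<close> vertices.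
  Exhaustive search over all pairs of \<open>3a\<close>-tuples, for decreasing clique sizes, therefore finds a
  maximum clique.
\<close>

section \<open>A loop language for the machine\<close>

text \<open>\<open>For r c\<close> runs \<open>c\<close> with register \<open>r\<close> set to \<open>n, n - 1, \<dots>, 0\<close> in turn (both ends included),
  where \<open>n\<close> is the content of register 0, which well-formed commands never write.
  Register 1 initially holds \<open>k\<close>, which the algorithm ignores; it serves as scratch space.\<close>

datatype com = Atom instr | Seq com com | When nat com | For nat com

type_synonym state = "(nat \<Rightarrow> nat) \<times> nat set"

text \<open>The program counter 0 is a dummy that \<open>snd\<close> discards. A round of a loop
  sets register 1 to 1 because the compiled loop loads the constant 1 there to decrement its
  counter.\<close>

fun sem :: "nat set set \<Rightarrow> com \<Rightarrow> state \<Rightarrow> state" where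
  "sem G (Atom i) s = snd (exec_instr G i (0, s))"
| "sem G (Seq c d) s = sem G d (sem G c s)"
| "sem G (When a c) s = (if fst s a = 0 then s else sem G c s)"
| "sem G (For r c) s =
     fold (\<lambda>i s. sem G c ((fst s)(r := i, 1 := 1), snd s)) (rev [0..<Suc (fst s 0)]) s"

text \<open>Without indirect addressing the written registers are known statically; the catch-all
  \<open>{}\<close> is sound because \<open>wf_instr\<close> rejects \<open>Load\<close> and
  \<open>Store\<close>.\<close>

fun instr_writes :: "instr \<Rightarrow> nat set" where
  "instr_writes (Const r v) = {r}"
| "instr_writes (Add r a b) = {r}"
| "instr_writes (Sub r a b) = {r}"
| "instr_writes (Edge r a b) = {r}"
| "instr_writes _ = {}"

fun writes :: "com \<Rightarrow> nat set" where
  "writes (Atom i) = instr_writes i"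
| "writes (Seq c d) = writes c \<union> writes d"
| "writes (When a c) = writes c"
| "writes (For r c) = insert r (insert 1 (writes c))"

fun wf_instr :: "instr \<Rightarrow> bool" where
  "wf_instr (Const r v) = (r \<noteq> 0)"
| "wf_instr (Add r a b) = (r \<noteq> 0)"
| "wf_instr (Sub r a b) = (r \<noteq> 0)"
| "wf_instr (Edge r a b) = (r \<noteq> 0)"
| "wf_instr (Out a) = True"
| "wf_instr _ = False"

text \<open>A loop body must leave its counter alone, since the compiled loop tests and decrements
  that very register.\<close>

fun wf_com :: "com \<Rightarrow> bool" where
  "wf_com (Atom i) = wf_instr i"
| "wf_com (Seq c d) = (wf_com c \<and> wf_com d)"
| "wf_com (When a c) = wf_com c"
| "wf_com (For r c) = (wf_com c \<and> r \<noteq> 0 \<and> r \<noteq> 1 \<and> r \<notin> writes c)"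

lemma sem_frame:
  "wf_com c \<Longrightarrow> x \<notin> writes c \<Longrightarrow> fst (sem G c s) x = fst s x"
proof (induction c arbitrary: s)
  case (Atom i)
  then show ?case by (cases s; cases i) auto
next
  case (For r c)
  have "fst (fold (\<lambda>i s. sem G c ((fst s)(r := i, 1 := 1), snd s)) is s) x = fst s x" for "is" s
    using For by (induction "is" arbitrary: s) auto
  then show ?case by (simp only: sem.simps)
qed auto

lemma zero_notin_writes: "wf_com c \<Longrightarrow> 0 \<notin> writes c"
proof (induction c)
  case (Atom i)
  then show ?case by (cases i) auto
qed auto

text \<open>\<open>I i\<close> describes the state once the values \<open>n, ..., i\<close> have
  been processed, so a run leads from \<open>I (Suc n)\<close> to \<open>I 0\<close>.\<close>

lemma sem_For_rule:
  assumes "n = fst s 0" "I (Suc n) s"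
    and "\<And>i R Os. i \<le> n \<Longrightarrow> I (Suc i) (R, Os) \<Longrightarrow> I i (sem G c (R(r := i, 1 := 1), Os))"
  shows "I 0 (sem G (For r c) s)"
proof -
  have "I 0 (fold (\<lambda>i s. sem G c ((fst s)(r := i, 1 := 1), snd s)) (rev [0..<m]) s)"
    if "m \<le> Suc n" "I m s" for m s
    using that
  proof (induction m arbitrary: s)
    case (Suc m)
    have "I m (sem G c ((fst s)(r := m, 1 := 1), snd s))"
      using Suc.prems by (intro assms(3)) auto
    from Suc.IH[OF _ this] Suc.prems(1) show ?case by (simp del: fun_upd_apply)
  qed simp
  from this[of "Suc n" s] show ?thesis
    using assms(1,2) by (simp only: sem.simps)
qed

section \<open>Compilation to machine code with a bound on the number of steps\<close>

fun csize :: "com \<Rightarrow> nat" where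
  "csize (Atom i) = 1"
| "csize (Seq c d) = csize c + csize d"
| "csize (When a c) = 1 + csize c"
| "csize (For r c) = 6 + csize c"

text \<open>Jump targets are absolute, hence the start address \<open>p\<close>. The counter starts
  at \<open>n + 1\<close> and is decremented before the body runs: the body sees
  \<open>n, ..., 0\<close>, and content 0 at the test ends the loop.\<close>

fun compile :: "nat \<Rightarrow> com \<Rightarrow> instr list" where
  "compile p (Atom i) = [i]"
| "compile p (Seq c d) = compile p c @ compile (p + csize c) d"
| "compile p (When a c) = Jz a (p + 1 + csize c) # compile (p + 1) c"
| "compile p (For r c) =
     [Const r 1, Add r r 0, Jz r (p + 6 + csize c), Const 1 1, Sub r r 1]
       @ compile (p + 5) c @ [Jmp (p + 2)]"

text \<open>An upper bound, as \<open>When\<close> may skip its body. In a loop, 3 counts the two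
  initial instructions and the last test; each round adds the test, \<open>Const\<close>,
  \<open>Sub\<close> and \<open>Jmp\<close>.\<close>

fun cost :: "nat \<Rightarrow> com \<Rightarrow> nat" where
  "cost n (Atom i) = 1"
| "cost n (Seq c d) = cost n c + cost n d"
| "cost n (When a c) = 1 + cost n c"
| "cost n (For r c) = 3 + (n + 1) * (cost n c + 4)"

lemma length_compile [simp]: "length (compile p c) = csize c"
  by (induction c arbitrary: p) auto

definition reaches :: "instr list \<Rightarrow> nat set set \<Rightarrow> nat \<Rightarrow> config \<Rightarrow> config \<Rightarrow> bool" where
  "reaches prog G t c c' \<longleftrightarrow> (\<exists>t'\<le>t. steps prog G t' c = c')"

lemma steps_add: "steps prog G (s + t) c = steps prog G t (steps prog G s c)"
  unfolding steps_def by (subst add.commute) (simp add: funpow_add)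

lemma reaches_trans:
  "reaches prog G s c c' \<Longrightarrow> reaches prog G t c' c'' \<Longrightarrow> reaches prog G (s + t) c c''"
  unfolding reaches_def by (metis add_mono steps_add)

lemma reaches_mono: "reaches prog G s c c' \<Longrightarrow> s \<le> t \<Longrightarrow> reaches prog G t c c'"
  unfolding reaches_def by (auto intro: le_trans)

lemma reaches_instr:
  assumes "p < length prog" "prog ! p = i" "i \<noteq> Halt"
  shows "reaches prog G 1 (p, s) (exec_instr G i (p, s))"
  unfolding reaches_def steps_def using assms
  by (intro exI[of _ 1]) (auto simp: step_def halted_def)

text \<open>Structural induction, with the surrounding code \<open>pre\<close> and
  \<open>post\<close> arbitrary so that the hypothesis applies to a subprogram at any
  address.\<close>

lemma reaches_compile:
  assumes "wf_com c" "prog = pre @ compile (length pre) c @ post" "fst s 0 = n"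
  shows "reaches prog G (cost n c) (length pre, s) (length pre + csize c, sem G c s)"
  using assms
proof (induction c arbitrary: pre post s)
  case (Atom i)
  have "reaches prog G 1 (length pre, s) (exec_instr G i (length pre, s))"
    using Atom by (intro reaches_instr) (auto simp: nth_append)
  moreover have "exec_instr G i (length pre, s) = (length pre + 1, sem G (Atom i) s)"
    using Atom by (cases i; cases s) auto
  ultimately show ?case by simp
next
  case (Seq c d)
  have "reaches prog G (cost n c) (length pre, s) (length pre + csize c, sem G c s)"
    using Seq.prems by (intro Seq.IH(1)[where post = "compile (length pre + csize c) d @ post"]) auto
  moreover have "reaches prog G (cost n d) (length (pre @ compile (length pre) c), sem G c s)
      (length (pre @ compile (length pre) c) + csize d, sem G d (sem G c s))"
    using Seq.prems
    by (intro Seq.IH(2)[where post = post]) (auto simp: sem_frame zero_notin_writes)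
  ultimately show ?case using reaches_trans by (auto simp: add.assoc)
next
  case (When a c)
  let ?p = "length pre"
  have jz: "reaches prog G 1 (?p, s) ((if fst s a = 0 then ?p + 1 + csize c else ?p + 1), s)"
    using reaches_instr[of ?p prog "Jz a (?p + 1 + csize c)" G s] When.prems
    by (cases s) (auto simp: nth_append)
  show ?case
  proof (cases "fst s a = 0")
    case True
    then show ?thesis using jz by (auto intro: reaches_mono)
  next
    case False
    have "reaches prog G (cost n c) (length (pre @ [Jz a (?p + 1 + csize c)]), s)
        (length (pre @ [Jz a (?p + 1 + csize c)]) + csize c, sem G c s)"
      using When.prems by (intro When.IH[where post = post]) auto
    then show ?thesis using jz False reaches_trans[OF jz] by simp
  qed
next
  case (For r c)
  let ?p = "length pre"
  let ?hd = "[Const r 1, Add r r 0, Jz r (?p + 6 + csize c), Const 1 1, Sub r r 1]"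
  let ?body = "\<lambda>i s. sem G c ((fst s)(r := i, 1 := 1), snd s)"
  have prog: "prog = pre @ ?hd @ compile (?p + 5) c @ [Jmp (?p + 2)] @ post"
    using For.prems(2) by simp
  have r: "r \<noteq> 0" "r \<noteq> 1" "r \<notin> writes c" "wf_com c"
    using For.prems(1) by auto
  have at: "?p + j < length prog \<and> prog ! (?p + j) = ?hd ! j" if "j < 5" for j
    unfolding prog using that by (simp only: nth_append) simp
  have atj: "?p + 5 + csize c < length prog \<and> prog ! (?p + 5 + csize c) = Jmp (?p + 2)"
    unfolding prog by (simp add: nth_append nth_Cons')
  have len: "length (pre @ ?hd) = ?p + 5" by simp
  note st = reaches_instr[OF conjunct1[OF at] conjunct2[OF at]]
  \<comment> \<open>Induction on the counter content \<open>m\<close> at the test: the values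
    \<open>m - 1, ..., 0\<close> are still to come.\<close>
  have loop: "reaches prog G (1 + m * (cost n c + 4)) (?p + 2, R, Os)
      (?p + 6 + csize c, fold ?body (rev [0..<m]) (R, Os))"
    if "R r = m" "R 0 = n" for m R Os
    using that
  proof (induction m arbitrary: R Os)
    case 0
    then show ?case using st[of 2 G "(R, Os)"] by simp
  next
    case (Suc m)
    let ?R = "R(1 := 1, r := m)"
    have 1: "reaches prog G 1 (?p + 2, R, Os) (?p + 3, R, Os)"
      using st[of 2 G "(R, Os)"] Suc.prems by (simp add: numeral_eq_Suc)
    have 2: "reaches prog G 1 (?p + 3, R, Os) (?p + 4, R(1 := 1), Os)"
      using st[of 3 G "(R, Os)"] by (simp add: numeral_eq_Suc)
    have 3: "reaches prog G 1 (?p + 4, R(1 := 1), Os) (?p + 5, ?R, Os)"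
      using st[of 4 G "(R(1 := 1), Os)"] Suc.prems r by (simp add: numeral_eq_Suc)
    have 4: "reaches prog G (cost n c) (?p + 5, ?R, Os) (?p + 5 + csize c, sem G c (?R, Os))"
      using For.IH[of "pre @ ?hd" "[Jmp (?p + 2)] @ post" "(?R, Os)", unfolded len] prog r Suc.prems
      by simp
    obtain R' Os' where s': "sem G c (?R, Os) = (R', Os')" by (cases "sem G c (?R, Os)")
    have R': "R' r = m" "R' 0 = n"
      using sem_frame[of c r G "(?R, Os)", unfolded s'] sem_frame[of c 0 G "(?R, Os)", unfolded s']
        r Suc.prems zero_notin_writes[of c] by auto
    have 5: "reaches prog G 1 (?p + 5 + csize c, sem G c (?R, Os)) (?p + 2, R', Os')"
      using reaches_instr[of "?p + 5 + csize c" prog "Jmp (?p + 2)" G "(R', Os')"] atj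
      unfolding s' by simp
    note 6 = Suc.IH[OF R', of Os']
    have "fold ?body (rev [0..<m]) (R', Os') = fold ?body (rev [0..<Suc m]) (R, Os)"
      using s' r by (simp add: fun_upd_twist)
    then show ?case
      using reaches_trans[OF 1 reaches_trans[OF 2 reaches_trans[OF 3
            reaches_trans[OF 4 reaches_trans[OF 5 6]]]]]
      by (simp only:) (erule reaches_mono, simp)
  qed
  obtain R Os where s: "s = (R, Os)" by (cases s)
  have 1: "reaches prog G 1 (?p, R, Os) (?p + 1, R(r := 1), Os)"
    using st[of 0 G "(R, Os)"] by simp
  have 2: "reaches prog G 1 (?p + 1, R(r := 1), Os) (?p + 2, R(r := Suc n), Os)"
    using st[of 1 G "(R(r := 1), Os)"] For.prems(3) r by (simp add: s)
  have 3: "reaches prog G (1 + Suc n * (cost n c + 4)) (?p + 2, R(r := Suc n), Os)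
      (?p + 6 + csize c, fold ?body (rev [0..<Suc n]) (R(r := Suc n), Os))"
    using loop[of "R(r := Suc n)" "Suc n" Os] For.prems(3) r by (simp add: s)
  have "fold ?body (rev [0..<Suc n]) (R(r := Suc n), Os) = sem G (For r c) s"
    using For.prems(3) by (simp add: s)
  moreover have "?p + 6 + csize c = ?p + csize (For r c)"
    "1 + (1 + (1 + Suc n * (cost n c + 4))) = cost n (For r c)" by simp_all
  ultimately show ?case
    using reaches_trans[OF 1 reaches_trans[OF 2 3]] by (simp only: s)
qed

text \<open>\<open>ram_output\<close> reads the configuration at the first halting time; a halted
  configuration never changes, so any later halting time shows the same output.\<close>

lemma ram_output_eqI:
  assumes "reaches prog G t c c'" "halted prog c'"
  shows "ram_output prog G c = Some (snd (snd c'))"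
proof -
  obtain t' where t': "steps prog G t' c = c'"
    using assms(1) by (auto simp: reaches_def)
  define l where "l = (LEAST t. halts_within prog G c t)"
  have ht: "halts_within prog G c t'"
    using t' assms(2) by (simp add: halts_within_def)
  hence hl: "halts_within prog G c l" and "l \<le> t'"
    unfolding l_def by (auto intro: LeastI Least_le)
  have "steps prog G m d = d" if "halted prog d" for m d
    unfolding steps_def using that by (induction m) (auto simp: step_def)
  from this[of "steps prog G l c" "t' - l"] have "steps prog G l c = c'"
    using hl \<open>l \<le> t'\<close> t' steps_add[of prog G l "t' - l" c] by (simp add: halts_within_def)
  then show ?thesis
    using ht unfolding ram_output_def l_def by auto
qed

lemma compile_correct:
  assumes "wf_com c"
  shows "\<exists>t\<le>cost n c. halts_within (compile 0 c) G (init_config n k) t"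
    and "ram_output (compile 0 c) G (init_config n k)
           = Some (snd (sem G c ((\<lambda>_. 0)(0 := n, 1 := k), {})))"
proof -
  let ?s = "((\<lambda>_. 0)(0 := n, 1 := k), {})"
  have *: "reaches (compile 0 c) G (cost n c) (init_config n k) (csize c, sem G c ?s)"
    using reaches_compile[OF assms, of "compile 0 c" "[]" "[]" ?s n G]
    by (simp add: init_config_def)
  have h: "halted (compile 0 c) (csize c, sem G c ?s)"
    by (simp add: halted_def)
  show "\<exists>t\<le>cost n c. halts_within (compile 0 c) G (init_config n k) t"
    using * h unfolding reaches_def halts_within_def by auto
  show "ram_output (compile 0 c) G (init_config n k) = Some (snd (sem G c ?s))"
    using ram_output_eqI[OF * h] by simp
qed

section \<open>The search algorithm\<close>

text \<open>The common closed neighbourhood of \<open>T\<close> without the exceptions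
  \<open>U\<close>. Lists may repeat entries, so sets of varying size fit a fixed tuple
  length.\<close>

definition candidate :: "nat \<Rightarrow> nat set set \<Rightarrow> nat list \<Rightarrow> nat list \<Rightarrow> nat set" where
  "candidate n G T U = {v. v < n \<and> (\<forall>t\<in>set T. v = t \<or> {v, t} \<in> G) \<and> v \<notin> set U}"

lemma candidate_subset: "candidate n G T U \<subseteq> {..<n}"
  by (auto simp: candidate_def)

lemma finite_candidate: "finite (candidate n G T U)"
  by (rule finite_subset[OF candidate_subset]) simp

text \<open>The empty block is not a no-op: it resets the scratch register 1.\<close>
primrec block :: "com list \<Rightarrow> com" where
  "block [] = Atom (Const 1 1)"
| "block (c # cs) = Seq c (block cs)"

lemma wf_block [simp]: "wf_com (block cs) \<longleftrightarrow> (\<forall>c\<in>set cs. wf_com c)"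
  by (induction cs) auto

lemma writes_block [simp]: "writes (block cs) = insert 1 (\<Union>c\<in>set cs. writes c)"
  by (induction cs) auto

lemma cost_block [simp]: "cost n (block cs) = sum_list (map (cost n) cs) + 1"
  by (induction cs) auto

text \<open>With truncated subtraction \<open>(x - y) + (y - x)\<close> is the distance, and 1 minus
  it is the equality bit.\<close>

definition eq_test :: "nat \<Rightarrow> nat \<Rightarrow> nat \<Rightarrow> com" where
  "eq_test z x y = block
     [Atom (Sub z x y), Atom (Sub 1 y x), Atom (Add z z 1), Atom (Const 1 1), Atom (Sub z 1 z)]"

text \<open>1 minus the sum of the equality bit and the adjacency bit: it is 1 exactly for distinct
  nonadjacent vertices.\<close>

definition far_test :: "nat \<Rightarrow> nat \<Rightarrow> nat \<Rightarrow> com" where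
  "far_test z x y = block
     [eq_test z x y, Atom (Edge 9 x y), Atom (Add z z 9), Atom (Const 1 1), Atom (Sub z 1 z)]"

lemma sem_eq_test:
  assumes "z \<notin> {1, x, y}" "x \<noteq> 1" "y \<noteq> 1"
  shows "sem G (eq_test z x y) (R, Os) = (R(z := (if R x = R y then 1 else 0), 1 := 1), Os)"
  using assms by (auto simp: eq_test_def fun_eq_iff)

lemma sem_far_test:
  assumes "z \<notin> {1, 9, x, y}" "x \<notin> {1, 9}" "y \<notin> {1, 9}"
  shows "sem G (far_test z x y) (R, Os) =
    (R(z := (if R x = R y \<or> {R x, R y} \<in> G then 0 else 1), 1 := 1,
       9 := (if {R x, R y} \<in> G then 1 else 0)), Os)"
  using assms by (auto simp: far_test_def sem_eq_test fun_eq_iff)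

lemma test_simps [simp]:
  "wf_com (eq_test z x y) \<longleftrightarrow> z \<noteq> 0" "wf_com (far_test z x y) \<longleftrightarrow> z \<noteq> 0"
  "writes (eq_test z x y) = {1, z}" "writes (far_test z x y) = {1, 9, z}"
  "cost n (eq_test z x y) = 6" "cost n (far_test z x y) = 11"
  by (auto simp: eq_test_def far_test_def)

text \<open>A test may clear the flag \<open>f\<close> but never raise it, so running tests in turn
  forms the conjunction of their conditions.\<close>

definition filters :: "nat set set \<Rightarrow> nat set \<Rightarrow> nat \<Rightarrow> com \<Rightarrow> ((nat \<Rightarrow> nat) \<Rightarrow> bool) \<Rightarrow> bool" where
  "filters G F f c P \<longleftrightarrow> (\<forall>R Os. \<exists>R'. sem G c (R, Os) = (R', Os) \<and>
     (R' f \<noteq> 0 \<longleftrightarrow> R f \<noteq> 0 \<and> P R) \<and> (\<forall>y. y \<notin> F \<longrightarrow> R' y = R y))"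

text \<open>The flag \<open>f\<close> starts as \<open>n - x\<close>, which is nonzero iff \<open>x < n\<close>.\<close>
definition member :: "nat list \<Rightarrow> nat list \<Rightarrow> nat \<Rightarrow> nat \<Rightarrow> com" where
  "member ts us f x = block [Atom (Sub f 0 x),
     block (map (\<lambda>t. block [far_test 8 x t, When 8 (Atom (Const f 0))]) ts),
     block (map (\<lambda>u. block [eq_test 8 x u, When 8 (Atom (Const f 0))]) us)]"

definition registers :: "nat list \<Rightarrow> bool" where
  "registers ts \<longleftrightarrow> (\<forall>t\<in>set ts. 12 \<le> t)"

text \<open>Register 0 and the tuple registers are all that a candidate depends on; 1 to 11 are work
  registers.\<close>

definition agree :: "(nat \<Rightarrow> nat) \<Rightarrow> (nat \<Rightarrow> nat) \<Rightarrow> bool" where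
  "agree R R' \<longleftrightarrow> (\<forall>y. y = 0 \<or> 12 \<le> y \<longrightarrow> R y = R' y)"

lemma agree_upd [simp]: "0 < y \<Longrightarrow> y < 12 \<Longrightarrow> agree (R(y := v)) R' \<longleftrightarrow> agree R R'"
  by (auto simp: agree_def)

lemma agree_refl [simp]: "agree R R"
  by (simp add: agree_def)

lemma agree_0: "agree R R' \<Longrightarrow> R 0 = R' 0"
  by (simp add: agree_def)

lemma agree_map: "agree R R' \<Longrightarrow> registers ts \<Longrightarrow> map R ts = map R' ts"
  by (auto simp: agree_def registers_def)

lemma filtersE:
  assumes "filters G F f c P"
  obtains R' where "sem G c (R, Os) = (R', Os)" "R' f \<noteq> 0 \<longleftrightarrow> R f \<noteq> 0 \<and> P R"
    "\<forall>y. y \<notin> F \<longrightarrow> R' y = R y"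
  using assms[unfolded filters_def, THEN spec, THEN spec, of R Os] by (elim exE conjE)

text \<open>By the second assumption the conditions ignore the registers in \<open>F\<close>, so
  earlier tests do not disturb later ones. Register 1 lies in \<open>F\<close> because the empty
  block resets it.\<close>

lemma filters_block_map:
  assumes "\<And>t. t \<in> set ts \<Longrightarrow> filters G F f (c t) (P t)"
    and "\<And>t R R'. t \<in> set ts \<Longrightarrow> \<forall>y. y \<notin> F \<longrightarrow> R' y = R y \<Longrightarrow> P t R' = P t R"
    and "1 \<in> F" "f \<noteq> 1"
  shows "filters G F f (block (map c ts)) (\<lambda>R. \<forall>t\<in>set ts. P t R)"
  using assms(1,2)
proof (induction ts)
  case Nil
  show ?case unfolding filters_def
  proof (intro allI)
    fix R Os
    show "\<exists>R'. sem G (block (map c [])) (R, Os) = (R', Os) \<and>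
        (R' f \<noteq> 0 \<longleftrightarrow> R f \<noteq> 0 \<and> (\<forall>t\<in>set []. P t R)) \<and> (\<forall>y. y \<notin> F \<longrightarrow> R' y = R y)"
      using assms(3,4) by (intro exI[of _ "R(1 := 1)"]) auto
  qed
next
  case (Cons t ts)
  have IH: "filters G F f (block (map c ts)) (\<lambda>R. \<forall>t\<in>set ts. P t R)"
    by (rule Cons.IH; rule Cons.prems; simp)
  show ?case unfolding filters_def
  proof (intro allI)
    fix R Os
    obtain R1 where R1: "sem G (c t) (R, Os) = (R1, Os)" "R1 f \<noteq> 0 \<longleftrightarrow> R f \<noteq> 0 \<and> P t R"
      "\<forall>y. y \<notin> F \<longrightarrow> R1 y = R y"
      by (rule filtersE[OF Cons.prems(1)[of t], of R Os]) auto
    obtain R2 where R2: "sem G (block (map c ts)) (R1, Os) = (R2, Os)"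
      "R2 f \<noteq> 0 \<longleftrightarrow> R1 f \<noteq> 0 \<and> (\<forall>t\<in>set ts. P t R1)" "\<forall>y. y \<notin> F \<longrightarrow> R2 y = R1 y"
      by (rule filtersE[OF IH, of R1 Os])
    have "P d R1 = P d R" if "d \<in> set ts" for d
      using Cons.prems(2)[of d R1 R] that R1(3) by simp
    then show "\<exists>R'. sem G (block (map c (t # ts))) (R, Os) = (R', Os) \<and>
        (R' f \<noteq> 0 \<longleftrightarrow> R f \<noteq> 0 \<and> (\<forall>t\<in>set (t # ts). P t R)) \<and> (\<forall>y. y \<notin> F \<longrightarrow> R' y = R y)"
      using R1 R2 by (intro exI[of _ R2]) auto
  qed
qed

lemma sem_member:
  assumes "registers ts" "registers us" "f = 6 \<or> f = 7" "x = 4 \<or> x = 5"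
  shows "\<exists>R'. sem G (member ts us f x) (R, Os) = (R', Os) \<and>
    (R' f \<noteq> 0 \<longleftrightarrow> R x \<in> candidate (R 0) G (map R ts) (map R us)) \<and>
    (\<forall>y. y \<notin> {1, 8, 9, f} \<longrightarrow> R' y = R y)"
proof -
  let ?F = "{1, 8, 9, f}"
  let ?c = "\<lambda>t. block [far_test 8 x t, When 8 (Atom (Const f 0))]"
  let ?d = "\<lambda>u. block [eq_test 8 x u, When 8 (Atom (Const f 0))]"
  have t12: "12 \<le> t" if "t \<in> set ts \<union> set us" for t
    using assms(1,2) that by (auto simp: registers_def)
  have 1: "filters G ?F f (block (map ?c ts)) (\<lambda>R. \<forall>t\<in>set ts. R x = R t \<or> {R x, R t} \<in> G)"
  proof (rule filters_block_map)
    fix t assume "t \<in> set ts"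
    hence t: "12 \<le> t" using t12 by simp
    show "filters G ?F f (?c t) (\<lambda>R. R x = R t \<or> {R x, R t} \<in> G)"
      unfolding filters_def
    proof (intro allI)
      fix R :: "nat \<Rightarrow> nat" and Os :: "nat set"
      let ?near = "R x = R t \<or> {R x, R t} \<in> G"
      let ?R = "R(8 := (if ?near then 0 else 1), 1 := 1, 9 := (if {R x, R t} \<in> G then 1 else 0))"
      let ?R' = "(if ?near then ?R else ?R(f := 0))(1 := 1)"
      have "sem G (far_test 8 x t) (R, Os) = (?R, Os)"
        using t assms(4) by (intro sem_far_test) auto
      hence "sem G (?c t) (R, Os) = (?R', Os)" by simp
      moreover have "?R' f \<noteq> 0 \<longleftrightarrow> R f \<noteq> 0 \<and> ?near" using assms(3) by auto
      moreover have "\<forall>y. y \<notin> ?F \<longrightarrow> ?R' y = R y" by simp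
      ultimately show "\<exists>R'. sem G (?c t) (R, Os) = (R', Os) \<and>
          (R' f \<noteq> 0 \<longleftrightarrow> R f \<noteq> 0 \<and> ?near) \<and> (\<forall>y. y \<notin> ?F \<longrightarrow> R' y = R y)"
        by (intro exI[of _ ?R'] conjI)
    qed
    fix R R' :: "nat \<Rightarrow> nat" assume "\<forall>y. y \<notin> ?F \<longrightarrow> R' y = R y"
    from this[rule_format, of x] this[rule_format, of t] t assms(3,4) have "R' x = R x" "R' t = R t" by auto
    then show "(R' x = R' t \<or> {R' x, R' t} \<in> G) = (R x = R t \<or> {R x, R t} \<in> G)" by simp
  qed (use assms(3) in auto)
  have 2: "filters G ?F f (block (map ?d us)) (\<lambda>R. \<forall>t\<in>set us. R x \<noteq> R t)"
  proof (rule filters_block_map)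
    fix t assume "t \<in> set us"
    hence t: "12 \<le> t" using t12 by simp
    show "filters G ?F f (?d t) (\<lambda>R. R x \<noteq> R t)"
      unfolding filters_def
    proof (intro allI)
      fix R :: "nat \<Rightarrow> nat" and Os :: "nat set"
      let ?R = "R(8 := (if R x = R t then 1 else 0), 1 := 1)"
      let ?R' = "(if R x = R t then ?R(f := 0) else ?R)(1 := 1)"
      have "sem G (eq_test 8 x t) (R, Os) = (?R, Os)"
        using t assms(4) by (intro sem_eq_test) auto
      hence "sem G (?d t) (R, Os) = (?R', Os)" by simp
      moreover have "?R' f \<noteq> 0 \<longleftrightarrow> R f \<noteq> 0 \<and> R x \<noteq> R t" using assms(3) by auto
      moreover have "\<forall>y. y \<notin> ?F \<longrightarrow> ?R' y = R y" by simp
      ultimately show "\<exists>R'. sem G (?d t) (R, Os) = (R', Os) \<and>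
          (R' f \<noteq> 0 \<longleftrightarrow> R f \<noteq> 0 \<and> R x \<noteq> R t) \<and> (\<forall>y. y \<notin> ?F \<longrightarrow> R' y = R y)"
        by (intro exI[of _ ?R'] conjI)
    qed
    fix R R' :: "nat \<Rightarrow> nat" assume "\<forall>y. y \<notin> ?F \<longrightarrow> R' y = R y"
    from this[rule_format, of x] this[rule_format, of t] t assms(3,4) have "R' x = R x" "R' t = R t" by auto
    then show "(R' x \<noteq> R' t) = (R x \<noteq> R t)" by simp
  qed (use assms(3) in auto)
  let ?R = "R(f := R 0 - R x)"
  obtain R1 where R1: "sem G (block (map ?c ts)) (?R, Os) = (R1, Os)"
    "R1 f \<noteq> 0 \<longleftrightarrow> ?R f \<noteq> 0 \<and> (\<forall>t\<in>set ts. ?R x = ?R t \<or> {?R x, ?R t} \<in> G)"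
    "\<forall>y. y \<notin> ?F \<longrightarrow> R1 y = ?R y"
    by (rule filtersE[OF 1, of ?R Os])
  obtain R2 where R2: "sem G (block (map ?d us)) (R1, Os) = (R2, Os)"
    "R2 f \<noteq> 0 \<longleftrightarrow> R1 f \<noteq> 0 \<and> (\<forall>t\<in>set us. R1 x \<noteq> R1 t)"
    "\<forall>y. y \<notin> ?F \<longrightarrow> R2 y = R1 y"
    by (rule filtersE[OF 2, of R1 Os])
  have R: "?R y = R y" if "y = x \<or> y \<in> set ts \<union> set us" for y
    using that t12[of y] assms(3,4) by auto
  have R1R: "R1 y = R y" if "y = x \<or> y \<in> set ts \<union> set us" for y
    using that t12[of y] assms(3,4) R1(3)[rule_format, of y] by auto
  have "(\<forall>t\<in>set ts. ?R x = ?R t \<or> {?R x, ?R t} \<in> G) \<longleftrightarrow> (\<forall>t\<in>set ts. R x = R t \<or> {R x, R t} \<in> G)"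
    using R[of x] R by (intro ball_cong) (simp_all del: fun_upd_apply)
  moreover have "(\<forall>t\<in>set us. R1 x \<noteq> R1 t) \<longleftrightarrow> (\<forall>t\<in>set us. R x \<noteq> R t)"
    using R1R[of x] R1R by (intro ball_cong) simp_all
  ultimately have "R2 f \<noteq> 0 \<longleftrightarrow> R x < R 0 \<and> (\<forall>t\<in>set ts. R x = R t \<or> {R x, R t} \<in> G) \<and>
      (\<forall>t\<in>set us. R x \<noteq> R t)"
    using R1(2) R2(2) by (simp add: not_le)
  hence "(R2(1 := 1)) f \<noteq> 0 \<longleftrightarrow> R x \<in> candidate (R 0) G (map R ts) (map R us)"
    using assms(3) by (auto simp: candidate_def)
  moreover have "sem G (member ts us f x) (R, Os) = (R2(1 := 1), Os)"
    unfolding member_def using R1(1) R2(1) by simp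
  moreover have "\<forall>y. y \<notin> ?F \<longrightarrow> (R2(1 := 1)) y = R y"
    using R1(3) R2(3) by simp
  ultimately show ?thesis by (intro exI[of _ "R2(1 := 1)"] conjI)
qed

lemma member_simps:
  "wf_com (member ts us f x) \<longleftrightarrow> f \<noteq> 0"
  "writes (member ts us f x) \<subseteq> {1, 8, 9, f}"
  "cost n (member ts us f x) = 14 * length ts + 9 * length us + 4"
  by (auto simp: member_def o_def sum_list_triv)

text \<open>Register usage: 2 is the flag recording that a clique has been output, 3 the clique size
  being searched for, 4 and 5 range over vertices, 6 and 7 hold membership flags, 8 and 9 are
  temporaries, 10 becomes nonzero if the candidate is not a clique, 11 counts its vertices; the
  registers from 12 on hold the two tuples describing the candidate.\<close>

definition far_check :: "nat list \<Rightarrow> nat list \<Rightarrow> com" where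
  "far_check ts us = For 5 (block [member ts us 7 5,
     When 7 (block [far_test 8 4 5, When 8 (Atom (Const 10 1))])])"

definition clique_check :: "nat list \<Rightarrow> nat list \<Rightarrow> com" where
  "clique_check ts us = For 4 (block [member ts us 6 4,
     When 6 (block [Atom (Const 1 1), Atom (Add 11 11 1), far_check ts us])])"

definition emit :: "nat list \<Rightarrow> nat list \<Rightarrow> com" where
  "emit ts us = For 4 (block [member ts us 6 4, When 6 (Atom (Out 4))])"

text \<open>Register 8 ends as 1 minus the sum of three failure indicators: wrong size, register 10
  (not a clique) and register 2 (a clique was already output). By truncation it is nonzero exactly
  when none of them is set.\<close>

definition try_candidate :: "nat list \<Rightarrow> nat list \<Rightarrow> com" where
  "try_candidate ts us = block [Atom (Const 10 0), Atom (Const 11 0), clique_check ts us,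
     eq_test 8 11 3, Atom (Sub 8 1 8), Atom (Add 8 8 10), Atom (Add 8 8 2), Atom (Sub 8 1 8),
     When 8 (block [Atom (Const 2 1), emit ts us])]"

section \<open>Correctness of testing one candidate\<close>

context
  fixes ts us :: "nat list"
  assumes regs: "registers ts" "registers us"
begin

lemma sem_member_agree:
  assumes "agree R R0" "f = 6 \<or> f = 7" "x = 4 \<or> x = 5"
  obtains R' where "sem G (member ts us f x) (R, Os) = (R', Os)" "agree R' R0"
    "R' f \<noteq> 0 \<longleftrightarrow> R x \<in> candidate (R0 0) G (map R0 ts) (map R0 us)"
    "\<forall>y. y \<notin> {1, 8, 9, f} \<longrightarrow> R' y = R y"
proof -
  obtain R' where R': "sem G (member ts us f x) (R, Os) = (R', Os)"
    "R' f \<noteq> 0 \<longleftrightarrow> R x \<in> candidate (R 0) G (map R ts) (map R us)"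
    "\<forall>y. y \<notin> {1, 8, 9, f} \<longrightarrow> R' y = R y"
    using sem_member[OF regs assms(2,3), of G R Os] by (elim exE conjE)
  have "agree R' R0"
    using assms R'(3) unfolding agree_def by auto
  moreover have "R' f \<noteq> 0 \<longleftrightarrow> R x \<in> candidate (R0 0) G (map R0 ts) (map R0 us)"
    using R'(2) agree_0[OF assms(1)] agree_map[OF assms(1)] regs by simp
  ultimately show ?thesis using R'(1,3) by (intro that[of R'])
qed

text \<open>The loop may set register 10 but never clears it, so the register accumulates failures
  over all \<open>v\<close> compared with the vertex in register 4.\<close>

lemma sem_far_check:
  assumes "agree R R0" and A: "A = candidate (R0 0) G (map R0 ts) (map R0 us)"
  obtains R' where "sem G (far_check ts us) (R, Os) = (R', Os)" "agree R' R0"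
    "R' 10 = 0 \<longleftrightarrow> R 10 = 0 \<and> (\<forall>v\<in>A. R 4 = v \<or> {R 4, v} \<in> G)"
    "\<forall>y. y \<notin> {1, 5, 7, 8, 9, 10} \<longrightarrow> R' y = R y"
proof -
  let ?I = "\<lambda>i s. snd s = Os \<and> agree (fst s) R0 \<and> (\<forall>y. y \<notin> {1, 5, 7, 8, 9, 10} \<longrightarrow> fst s y = R y) \<and>
     (fst s 10 = 0 \<longleftrightarrow> R 10 = 0 \<and> (\<forall>v\<in>A. i \<le> v \<longrightarrow> R 4 = v \<or> {R 4, v} \<in> G))"
  have "?I 0 (sem G (far_check ts us) (R, Os))"
    unfolding far_check_def
  proof (rule sem_For_rule[where I = ?I and n = "R0 0"])
    show "R0 0 = fst (R, Os) 0" using agree_0[OF assms(1)] by simp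
    show "?I (Suc (R0 0)) (R, Os)"
      using assms(1) by (auto simp: A candidate_def)
  next
    fix i R1 Os1
    assume I: "?I (Suc i) (R1, Os1)"
    have ag: "agree (R1(5 := i, 1 := 1)) R0" using I by simp
    obtain R2 where R2: "sem G (member ts us 7 5) (R1(5 := i, 1 := 1), Os1) = (R2, Os1)"
      "agree R2 R0" "R2 7 \<noteq> 0 \<longleftrightarrow> (R1(5 := i, 1 := 1)) 5 \<in> A"
      "\<forall>y. y \<notin> {1, 8, 9, 7} \<longrightarrow> R2 y = (R1(5 := i, 1 := 1)) y"
      by (rule sem_member_agree[OF ag disjI2[OF refl] disjI2[OF refl], of G Os1, folded A])
    hence mem: "R2 7 \<noteq> 0 \<longleftrightarrow> i \<in> A" by simp
    have ge: "(\<forall>v\<in>A. i \<le> v \<longrightarrow> Q v) \<longleftrightarrow> (\<forall>v\<in>A. Suc i \<le> v \<longrightarrow> Q v) \<and> (i \<in> A \<longrightarrow> Q i)" for Q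
      by (auto simp: Suc_le_eq le_less)
    have vals: "R2 4 = R 4" "R2 5 = i" "R2 10 = R1 10"
      using R2(4)[rule_format, of 4] R2(4)[rule_format, of 5] R2(4)[rule_format, of 10] I by auto
    have frame: "\<forall>y. y \<notin> {1, 5, 7, 8, 9, 10} \<longrightarrow> R2 y = R y"
    proof (intro allI impI)
      fix y :: nat assume y: "y \<notin> {1, 5, 7, 8, 9, 10}"
      hence "R2 y = R1 y" using R2(4)[rule_format, of y] by simp
      also have "\<dots> = R y" using I y by simp
      finally show "R2 y = R y" .
    qed
    let ?c = "block [member ts us 7 5, When 7 (block [far_test 8 4 5, When 8 (Atom (Const 10 1))])]"
    let ?near = "R 4 = i \<or> {R 4, i} \<in> G"
    show "?I i (sem G ?c (R1(5 := i, 1 := 1), Os1))"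
    proof (cases "i \<in> A")
      case False
      have run: "sem G ?c (R1(5 := i, 1 := 1), Os1) = (R2(1 := 1), Os1)"
        using R2(1) mem False by simp
      show ?thesis
        unfolding ge run using I R2(2) vals False frame by simp
    next
      case True
      define R3 where "R3 = R2(8 := (if ?near then 0 else 1), 1 := 1, 9 := (if {R 4, i} \<in> G then 1 else 0))"
      have "sem G (far_test 8 4 5) (R2, Os1) = (R3, Os1)"
        unfolding R3_def using vals by (simp add: sem_far_test)
      hence run: "sem G ?c (R1(5 := i, 1 := 1), Os1) = ((if ?near then R3 else R3(10 := 1))(1 := 1), Os1)"
        using R2(1) mem True by (simp add: R3_def)
      show ?thesis
        unfolding ge run using I R2(2) vals True frame by (simp add: R3_def)
    qed
  qed
  then show ?thesis
    by (intro that[of "fst (sem G (far_check ts us) (R, Os))"]) (auto simp: prod_eq_iff)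
qed

lemma sem_clique_check:
  assumes "agree R R0" and A: "A = candidate (R0 0) G (map R0 ts) (map R0 us)"
    and "R 10 = 0" "R 11 = 0"
  obtains R' where "sem G (clique_check ts us) (R, Os) = (R', Os)" "agree R' R0"
    "R' 10 = 0 \<longleftrightarrow> is_clique (R0 0) G A" "R' 11 = card A"
    "R' 2 = R 2" "R' 3 = R 3"
proof -
  have fin: "finite A" unfolding A by (rule finite_candidate)
  \<comment> \<open>Only the outer vertex \<open>u\<close> is bounded by \<open>i\<close>: the inner
    loop compares it with the whole candidate.\<close>
  let ?I = "\<lambda>i s. snd s = Os \<and> agree (fst s) R0 \<and> fst s 2 = R 2 \<and> fst s 3 = R 3 \<and>
     fst s 11 = card {u \<in> A. i \<le> u} \<and>
     (fst s 10 = 0 \<longleftrightarrow> (\<forall>u\<in>A. i \<le> u \<longrightarrow> (\<forall>v\<in>A. u = v \<or> {u, v} \<in> G)))"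
  have "?I 0 (sem G (clique_check ts us) (R, Os))"
    unfolding clique_check_def
  proof (rule sem_For_rule[where I = ?I and n = "R0 0"])
    show "R0 0 = fst (R, Os) 0" using agree_0[OF assms(1)] by simp
    have "{u \<in> A. Suc (R0 0) \<le> u} = {}"
      by (auto simp: A candidate_def)
    then show "?I (Suc (R0 0)) (R, Os)"
      using assms by (simp only:) (auto simp: candidate_def)
  next
    fix i R1 Os1
    assume I: "?I (Suc i) (R1, Os1)"
    have ag: "agree (R1(4 := i, 1 := 1)) R0" using I by simp
    obtain R2 where R2: "sem G (member ts us 6 4) (R1(4 := i, 1 := 1), Os1) = (R2, Os1)"
      "agree R2 R0" "R2 6 \<noteq> 0 \<longleftrightarrow> (R1(4 := i, 1 := 1)) 4 \<in> A"
      "\<forall>y. y \<notin> {1, 8, 9, 6} \<longrightarrow> R2 y = (R1(4 := i, 1 := 1)) y"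
      by (rule sem_member_agree[OF ag disjI1[OF refl] disjI1[OF refl], of G Os1, folded A])
    hence mem: "R2 6 \<noteq> 0 \<longleftrightarrow> i \<in> A" by simp
    have vals: "R2 2 = R 2" "R2 3 = R 3" "R2 4 = i" "R2 10 = R1 10" "R2 11 = R1 11"
      using R2(4)[rule_format, of 4] R2(4)[rule_format, of 2] R2(4)[rule_format, of 3] R2(4)[rule_format, of 10] R2(4)[rule_format, of 11] I by auto
    have ge: "(\<forall>v\<in>A. i \<le> v \<longrightarrow> Q v) \<longleftrightarrow> (\<forall>v\<in>A. Suc i \<le> v \<longrightarrow> Q v) \<and> (i \<in> A \<longrightarrow> Q i)" for Q
      by (auto simp: Suc_le_eq le_less)
    let ?c = "block [member ts us 6 4,
        When 6 (block [Atom (Const 1 1), Atom (Add 11 11 1), far_check ts us])]"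
    show "?I i (sem G ?c (R1(4 := i, 1 := 1), Os1))"
    proof (cases "i \<in> A")
      case False
      have "{u \<in> A. i \<le> u} = {u \<in> A. Suc i \<le> u}"
        using False by (auto simp: Suc_le_eq le_less)
      then show ?thesis
        unfolding ge using I R2(1,2) mem vals False by simp
    next
      case True
      have "{u \<in> A. i \<le> u} = insert i {u \<in> A. Suc i \<le> u}"
        using True by (auto simp: Suc_le_eq le_less)
      hence card: "card {u \<in> A. i \<le> u} = Suc (card {u \<in> A. Suc i \<le> u})"
        using fin by simp
      let ?R = "R2(1 := 1, 11 := Suc (R2 11))"
      have "agree ?R R0" using R2(2) by simp
      then obtain R3 where R3: "sem G (far_check ts us) (?R, Os1) = (R3, Os1)" "agree R3 R0"
        "R3 10 = 0 \<longleftrightarrow> ?R 10 = 0 \<and> (\<forall>v\<in>A. ?R 4 = v \<or> {?R 4, v} \<in> G)"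
        "\<forall>y. y \<notin> {1, 5, 7, 8, 9, 10} \<longrightarrow> R3 y = ?R y"
        by (rule sem_far_check[OF _ A, of ?R Os1])
      have vals3: "R3 2 = R 2" "R3 3 = R 3" "R3 11 = Suc (R1 11)"
        using R3(4)[rule_format, of 2] R3(4)[rule_format, of 3] R3(4)[rule_format, of 11] vals by auto
      have run: "sem G ?c (R1(4 := i, 1 := 1), Os1) = (R3(1 := 1), Os1)"
        using R2(1) mem R3(1) True by simp
      show ?thesis
        unfolding ge card run using I R3(2,3) vals vals3 True by simp
    qed
  qed
  moreover have "A \<subseteq> {..<R0 0}"
    unfolding A by (rule candidate_subset)
  hence "is_clique (R0 0) G A \<longleftrightarrow> (\<forall>u\<in>A. \<forall>v\<in>A. u = v \<or> {u, v} \<in> G)"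
    unfolding is_clique_def by blast
  ultimately show ?thesis
    by (intro that[of "fst (sem G (clique_check ts us) (R, Os))"]) (auto simp: prod_eq_iff)
qed

lemma sem_emit:
  assumes "agree R R0" and A: "A = candidate (R0 0) G (map R0 ts) (map R0 us)"
  obtains R' where "sem G (emit ts us) (R, Os) = (R', Os \<union> A)" "R' 2 = R 2"
proof -
  let ?I = "\<lambda>i s. snd s = Os \<union> {v \<in> A. i \<le> v} \<and> agree (fst s) R0 \<and> fst s 2 = R 2"
  have "?I 0 (sem G (emit ts us) (R, Os))"
    unfolding emit_def
  proof (rule sem_For_rule[where I = ?I and n = "R0 0"])
    show "R0 0 = fst (R, Os) 0" using agree_0[OF assms(1)] by simp
    show "?I (Suc (R0 0)) (R, Os)"
      using assms(1) by (auto simp: A candidate_def)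
  next
    fix i R1 Os1
    assume I: "?I (Suc i) (R1, Os1)"
    have ag: "agree (R1(4 := i, 1 := 1)) R0" using I by simp
    obtain R2 where R2: "sem G (member ts us 6 4) (R1(4 := i, 1 := 1), Os1) = (R2, Os1)"
      "agree R2 R0" "R2 6 \<noteq> 0 \<longleftrightarrow> (R1(4 := i, 1 := 1)) 4 \<in> A"
      "\<forall>y. y \<notin> {1, 8, 9, 6} \<longrightarrow> R2 y = (R1(4 := i, 1 := 1)) y"
      by (rule sem_member_agree[OF ag disjI1[OF refl] disjI1[OF refl], of G Os1, folded A])
    hence mem: "R2 6 \<noteq> 0 \<longleftrightarrow> i \<in> A" by simp
    have vals: "R2 4 = i" "R2 2 = R 2"
      using R2(4)[rule_format, of 4] R2(4)[rule_format, of 2] I by auto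
    have ge: "{v \<in> A. i \<le> v} = {v \<in> A. Suc i \<le> v} \<union> (if i \<in> A then {i} else {})"
      by (auto simp: Suc_le_eq le_less)
    have run: "sem G (block [member ts us 6 4, When 6 (Atom (Out 4))]) (R1(4 := i, 1 := 1), Os1)
        = (R2(1 := 1), if i \<in> A then insert i Os1 else Os1)"
      using R2(1) mem vals by (cases "i \<in> A") simp_all
    show "?I i (sem G (block [member ts us 6 4, When 6 (Atom (Out 4))]) (R1(4 := i, 1 := 1), Os1))"
      unfolding ge run using I R2(2) vals by simp
  qed
  then show ?thesis
    by (intro that[of "fst (sem G (emit ts us) (R, Os))"]) (auto simp: prod_eq_iff)
qed

lemma sem_try_candidate:
  assumes A: "A = candidate (R 0) G (map R ts) (map R us)"
    and ok: "ok \<longleftrightarrow> R 2 = 0 \<and> is_clique (R 0) G A \<and> card A = R 3"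
  shows "snd (sem G (try_candidate ts us) (R, Os)) = (if ok then Os \<union> A else Os)"
    and "fst (sem G (try_candidate ts us) (R, Os)) 2 = (if ok then 1 else R 2)"
proof -
  have init: "agree (R(10 := 0, 11 := 0)) R" "(R(10 := 0, 11 := 0)) 10 = 0" "(R(10 := 0, 11 := 0)) 11 = 0"
    by simp_all
  obtain R1 where R1: "sem G (clique_check ts us) (R(10 := 0, 11 := 0), Os) = (R1, Os)" "agree R1 R"
    "R1 10 = 0 \<longleftrightarrow> is_clique (R 0) G A" "R1 11 = card A"
    "R1 2 = (R(10 := 0, 11 := 0)) 2" "R1 3 = (R(10 := 0, 11 := 0)) 3"
    by (rule sem_clique_check[OF init(1) A init(2,3), of Os])
  define e :: nat where "e = (if card A = R 3 then 1 else 0)"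
  define z where "z = 1 - (1 - e + R1 10 + R1 2)"
  define W where "W = When 8 (block [Atom (Const 2 1), emit ts us])"
  define R2 where "R2 = R1(1 := 1, 8 := z, 2 := 1)"
  have "agree R2 R" using R1(2) by (simp add: R2_def)
  then obtain R3
    where R3: "sem G (emit ts us) (R2, Os) = (R3, Os \<union> A)" "R3 2 = R2 2"
    by (rule sem_emit[OF _ A, of R2 Os])
  have z: "z \<noteq> 0 \<longleftrightarrow> ok"
    unfolding z_def e_def ok using R1(3,5) by auto
  have "sem G (eq_test 8 11 3) (R1, Os) = (R1(8 := e, 1 := 1), Os)"
    using R1(4,6) by (simp add: sem_eq_test e_def)
  hence "sem G (try_candidate ts us) (R, Os) = sem G (Seq W (block [])) (R1(1 := 1, 8 := z), Os)"
    unfolding try_candidate_def W_def[symmetric] using R1(1) by (simp add: z_def)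
  also have "\<dots> = (if ok then (R3(1 := 1), Os \<union> A) else (R1(1 := 1, 8 := z), Os))"
    using z R3(1) by (cases ok) (simp_all add: R2_def W_def fun_eq_iff)
  finally have *: "sem G (try_candidate ts us) (R, Os) = \<dots>" .
  show "snd (sem G (try_candidate ts us) (R, Os)) = (if ok then Os \<union> A else Os)"
    unfolding * by simp
  show "fst (sem G (try_candidate ts us) (R, Os)) 2 = (if ok then 1 else R 2)"
    unfolding * using R3(2) R1(5) by (simp add: R2_def)
qed

end

lemma try_candidate_simps:
  "wf_com (try_candidate ts us)"
  "writes (try_candidate ts us) \<subseteq> {1, 2, 4, 5, 6, 7, 8, 9, 10, 11}"
  using member_simps(2)[of ts us 6 4] member_simps(2)[of ts us 7 5]
  by (auto simp: try_candidate_def clique_check_def far_check_def emit_def member_simps(1))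

text \<open>Two nested vertex loops, each round dominated by a membership test linear in the tuple
  lengths; 1000 is a generous constant.\<close>

lemma cost_try_candidate:
  "cost n (try_candidate ts us) \<le> 1000 * (length ts + length us + 1) * (n + 1)\<^sup>2"
  by (simp add: try_candidate_def clique_check_def far_check_def emit_def member_simps
      power2_eq_square algebra_simps)

section \<open>Enumeration of all tuples by nested loops\<close>

primrec nest :: "nat list \<Rightarrow> com \<Rightarrow> com" where
  "nest [] c = c"
| "nest (r # rs) c = For r (nest rs c)"

lemma writes_nest: "writes (nest rs c) \<subseteq> insert 1 (set rs \<union> writes c)"
  by (induction rs) auto

lemma wf_nest:
  assumes "wf_com c" "distinct rs" "set rs \<inter> ({0, 1} \<union> writes c) = {}"
  shows "wf_com (nest rs c)"
  using assms(2,3)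
proof (induction rs)
  case (Cons r rs)
  then show ?case using writes_nest[of rs c] by auto
qed (use assms in simp)

text \<open>The loops themselves write only their counters and register 1, so a property kept by the
  body and insensitive to those registers survives the whole nest.\<close>

lemma sem_nest_invariant:
  assumes "P s" "\<And>s. P s \<Longrightarrow> P (sem G c s)"
    and "\<And>R Os x v. x \<in> insert 1 (set rs) \<Longrightarrow> P (R, Os) \<Longrightarrow> P (R(x := v), Os)"
  shows "P (sem G (nest rs c) s)"
  using assms(1,3)
proof (induction rs arbitrary: s)
  case Nil
  then show ?case using assms(2) by simp
next
  case (Cons r rs)
  have "(\<lambda>_. P) (0 :: nat) (sem G (For r (nest rs c)) s)"
  proof (rule sem_For_rule[OF refl])
    fix i R Os assume "P (R, Os)"
    hence "P (R(r := i, 1 := 1), Os)"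
      by (intro Cons.prems(2)) auto
    then show "P (sem G (nest rs c) (R(r := i, 1 := 1), Os))"
      using Cons.prems(2) by (intro Cons.IH) auto
  qed (use Cons.prems in auto)
  then show ?case by simp
qed

text \<open>The nest visits every tuple over \<open>{..n}\<close>. The visit to \<open>vs\<close>
  establishes \<open>Q\<close>, which all later rounds keep; \<open>P\<close> is a background
  invariant available at that visit.\<close>

lemma sem_nest_hit:
  assumes "P s" "\<And>s. P s \<Longrightarrow> P (sem G c s)" "\<And>s. P s \<Longrightarrow> fst s 0 = n"
    and "\<And>R Os x v. x \<in> insert 1 (set rs) \<Longrightarrow> P (R, Os) \<Longrightarrow> P (R(x := v), Os)"
    and Q: "\<And>s. Q s \<Longrightarrow> Q (sem G c s)"
    and "\<And>R Os x v. x \<in> insert 1 (set rs) \<Longrightarrow> Q (R, Os) \<Longrightarrow> Q (R(x := v), Os)"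
    and "\<And>s. P s \<Longrightarrow> map (fst s) rs = vs \<Longrightarrow> Q (sem G c s)"
    and "length vs = length rs" "set vs \<subseteq> {..n}"
    and wf: "wf_com c" and "distinct rs" "set rs \<inter> ({0, 1} \<union> writes c) = {}"
  shows "Q (sem G (nest rs c) s)"
  using assms(1-4,6-9,11,12)
proof (induction rs arbitrary: P s vs)
  case Nil
  then show ?case by simp
next
  case (Cons r rs)
  note P = Cons.prems(1-4) and Q_upd = Cons.prems(5) and hit = Cons.prems(6)
  obtain v ws where vs: "vs = v # ws" using Cons.prems(7) by (cases vs) auto
  \<comment> \<open>Values decrease, so \<open>Q\<close> is claimed once the loop has passed
    \<open>v\<close>; as \<open>v \<le> n\<close>, it is not claimed at the start.\<close>
  define I where "I = (\<lambda>i s. P s \<and> (i \<le> v \<longrightarrow> Q s))"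
  have "I 0 (sem G (For r (nest rs c)) s)"
  proof (rule sem_For_rule[where n = n])
    show "n = fst s 0" using P by simp
    show "I (Suc n) s" using P Cons.prems(8) by (auto simp: I_def vs)
  next
    fix i R Os
    assume I: "I (Suc i) (R, Os)"
    let ?s = "(R(r := i, 1 := 1), Os)"
    have "P ?s" using I by (auto simp: I_def intro!: P(4))
    have 1: "P (sem G (nest rs c) ?s)"
    proof (rule sem_nest_invariant[where P = P])
      show "P (R(x := w), Os)" if "x \<in> insert 1 (set rs)" "P (R, Os)" for R Os x w
        using that by (intro P(4)) auto
    qed (fact \<open>P ?s\<close> P(2))+
    have 2: "Q (sem G (nest rs c) ?s)" if "i < v"
    proof -
      have "Q ?s" using I that by (auto simp: I_def intro!: Q_upd)
      then show ?thesis
      proof (rule sem_nest_invariant[where P = Q])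
        show "Q (R(x := w), Os)" if "x \<in> insert 1 (set rs)" "Q (R, Os)" for R Os x w
          using that by (intro Q_upd) auto
      qed (fact Q)
    qed
    \<comment> \<open>In this round the value of the outer counter joins the invariant, and the
      inner loops only have to hit the remaining tuple \<open>ws\<close>.\<close>
    have 3: "Q (sem G (nest rs c) ?s)" if "i = v"
    proof (rule Cons.IH[where P = "\<lambda>s. P s \<and> fst s r = v" and vs = ws])
      show "P ?s \<and> fst ?s r = v" using \<open>P ?s\<close> Cons.prems(10) that by auto
      show "P (sem G c s) \<and> fst (sem G c s) r = v" if "P s \<and> fst s r = v" for s
        using that P(2) sem_frame[OF wf] Cons.prems(10) by auto
      show "P (R(x := w), Os) \<and> fst (R(x := w), Os) r = v"
        if "x \<in> insert 1 (set rs)" "P (R, Os) \<and> fst (R, Os) r = v" for R Os x w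
      proof
        show "P (R(x := w), Os)" using that by (intro P(4)) auto
        show "fst (R(x := w), Os) r = v" using that Cons.prems(9,10) by auto
      qed
      show "Q (sem G c s)" if "P s \<and> fst s r = v" "map (fst s) rs = ws" for s
        using that hit by (simp add: vs)
    qed (use P Q_upd Cons.prems vs in auto)
    show "I i (sem G (nest rs c) ?s)"
      using 1 2 3 unfolding I_def by (metis le_neq_implies_less)
  qed
  then show ?case by (simp add: I_def)
qed

text \<open>As the body costs at least 1, the overhead 3 and the factor \<open>cost n c + 4\<close>
  are absorbed by 3 and 5 times \<open>(n + 1) * cost n c\<close>.\<close>

lemma cost_For_le: "1 \<le> cost n c \<Longrightarrow> cost n (For r c) \<le> 8 * (n + 1) * cost n c"
  using mult_le_mono2[of 1 "cost n c" "n + 1"] by (simp add: algebra_simps)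

lemma cost_pos: "1 \<le> cost n c"
  by (induction c) auto

lemma cost_nest_le: "cost n (nest rs c) \<le> (8 * (n + 1)) ^ length rs * cost n c"
proof (induction rs)
  case (Cons r rs)
  have "cost n (nest (r # rs) c) \<le> 8 * (n + 1) * cost n (nest rs c)"
    using cost_For_le[OF cost_pos] by (simp del: cost.simps)
  also have "\<dots> \<le> 8 * (n + 1) * ((8 * (n + 1)) ^ length rs * cost n c)"
    using Cons by (rule mult_left_mono) simp
  finally show ?case by (simp add: mult.assoc)
qed simp

section \<open>The full search: correctness and running time\<close>

definition T_regs :: "nat \<Rightarrow> nat list" where "T_regs L = [12..<12 + L]"
definition U_regs :: "nat \<Rightarrow> nat list" where "U_regs L = [12 + L..<12 + 2 * L]"

text \<open>Register 3 runs through the sizes downwards and register 2 blocks all output after the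
  first, so the first clique found is a largest candidate clique.\<close>

definition clique_search :: "nat \<Rightarrow> com" where
  "clique_search L =
     For 3 (nest (T_regs L @ U_regs L) (try_candidate (T_regs L) (U_regs L)))"

lemma regs_props:
  "registers (T_regs L)" "registers (U_regs L)" "length (T_regs L) = L" "length (U_regs L) = L"
  "distinct (T_regs L @ U_regs L)" "set (T_regs L @ U_regs L) \<subseteq> {12..}"
  by (auto simp: T_regs_def U_regs_def registers_def)

lemma wf_clique_search: "wf_com (clique_search L)"
proof -
  let ?c = "try_candidate (T_regs L) (U_regs L)"
  have disj: "set (T_regs L @ U_regs L) \<inter> ({0, 1} \<union> writes ?c) = {}"
    using try_candidate_simps(2)[of "T_regs L" "U_regs L"] regs_props(6)[of L] by fastforce
  have "wf_com (nest (T_regs L @ U_regs L) ?c)"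
    using disj regs_props(5) try_candidate_simps(1) by (intro wf_nest) auto
  moreover have "3 \<notin> writes (nest (T_regs L @ U_regs L) ?c)"
    using writes_nest[of "T_regs L @ U_regs L" ?c] try_candidate_simps(2)[of "T_regs L" "U_regs L"]
      regs_props(6)[of L] by fastforce
  ultimately show ?thesis by (simp add: clique_search_def)
qed

text \<open>One describable maximum clique suffices: no clique exceeds its size, and at the latest
  its own pair of tuples triggers the output.\<close>

lemma sem_clique_search:
  assumes D: "is_max_clique n G (candidate n G T U)"
    and T: "length T = L" "set T \<subseteq> {..n}" and U: "length U = L" "set U \<subseteq> {..n}"
  shows "is_max_clique n G (snd (sem G (clique_search L) ((\<lambda>_. 0)(0 := n, 1 := k), {})))"
proof -
  let ?ts = "T_regs L" and ?us = "U_regs L"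
  let ?c = "try_candidate ?ts ?us" and ?rs = "T_regs L @ U_regs L"
  define w where "w = card (candidate n G T U)"
  \<comment> \<open>\<open>Q\<close> is success, \<open>J\<close> excludes wrong output, and
    \<open>P i\<close> is \<open>J\<close> while size \<open>i\<close> is being tried.\<close>
  define Q where "Q = (\<lambda>s::state. fst s 2 = 1 \<and> is_max_clique n G (snd s))"
  define J where "J = (\<lambda>s::state. (fst s 2 = 0 \<and> snd s = {}) \<or> Q s)"
  define P where "P = (\<lambda>i s. fst s 0 = n \<and> fst s 3 = i \<and> J s)"
  have disj: "set ?rs \<inter> ({0, 1} \<union> writes ?c) = {}" and rs3: "x \<in> set ?rs \<Longrightarrow> 12 \<le> x" for x
    using try_candidate_simps(2)[of ?ts ?us] regs_props(6)[of L] by fastforce+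
  note wf = try_candidate_simps(1)[of ?ts ?us]
  have w: "is_clique n G A \<Longrightarrow> card A \<le> w" for A
    using D by (simp add: is_max_clique_def w_def)
  have fr: "fst (sem G ?c s) 0 = fst s 0" "fst (sem G ?c s) 3 = fst s 3" for s
    using try_candidate_simps(2)[of ?ts ?us] by (auto intro!: sem_frame[OF wf])
  note attempt = sem_try_candidate[OF regs_props(1,2)[of L] refl refl]
  have Qc: "Q (sem G ?c s)" if "Q s" for s
    using that attempt[of G "fst s" "snd s"] by (simp add: Q_def)
  \<comment> \<open>No clique has more than \<open>w\<close> vertices, so a clique of size
    \<open>i \<ge> w\<close> is maximum and any output at this stage is right.\<close>
  have Pc: "P i (sem G ?c s)" if "P i s" "w \<le> i" for i s
  proof (cases "Q s")
    case True
    then show ?thesis using Qc that fr by (auto simp: P_def J_def)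
  next
    case False
    have "is_max_clique n G A" if "is_clique n G A" "card A = i" for A
      using that w \<open>w \<le> i\<close> by (auto simp: is_max_clique_def intro: le_trans)
    then show ?thesis using False that fr attempt[of G "fst s" "snd s"]
      by (auto simp: P_def J_def Q_def)
  qed
  have Qu: "Q (R(x := v), Os)" if "x \<in> insert 1 (set ?rs)" "Q (R, Os)" for R Os x v
    using that rs3[of x] by (auto simp: Q_def)
  have Pu: "P i (R(x := v), Os)" if "x \<in> insert 1 (set ?rs)" "P i (R, Os)" for R Os x v i
    using that rs3[of x] by (auto simp: P_def J_def Q_def)
  have hit: "Q (sem G ?c s)" if "P w s" "map (fst s) ?rs = T @ U" for s
  proof (cases "Q s")
    case False
    have "map (fst s) ?ts = T" "map (fst s) ?us = U"
      using that(2) T(1) regs_props(3)[of L] by (auto simp: append_eq_append_conv)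
    then show ?thesis using False that(1) D attempt[of G "fst s" "snd s"]
      by (auto simp: P_def J_def Q_def w_def is_max_clique_def)
  qed (use Qc in simp)
  have 0: "0 \<notin> writes (nest ?rs ?c)"
    using wf_clique_search[of L] zero_notin_writes by (simp add: clique_search_def)
  \<comment> \<open>Above size \<open>w\<close> only \<open>J\<close> is guaranteed; the round for
    size \<open>w\<close> itself secures \<open>Q\<close>.\<close>
  define I where "I = (\<lambda>i s. fst s 0 = n \<and> (if w < i then J s else Q s))"
  have "I 0 (sem G (clique_search L) ((\<lambda>_. 0)(0 := n, 1 := k), {}))"
    unfolding clique_search_def
  proof (rule sem_For_rule[where n = n])
    have "w \<le> card {..<n}" unfolding w_def by (intro card_mono candidate_subset) simp
    then show "I (Suc n) ((\<lambda>_. 0)(0 := n, 1 := k), {})" by (simp add: I_def J_def)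
  next
    fix i R Os
    assume I: "I (Suc i) (R, Os)"
    let ?s = "(R(3 := i, 1 := 1), Os)"
    have "fst (sem G (nest ?rs ?c) ?s) 0 = n"
      using sem_frame[OF _ 0] wf_clique_search[of L] I by (auto simp: clique_search_def I_def)
    moreover have "J (sem G (nest ?rs ?c) ?s)" if "w < i"
    proof -
      have "P i ?s" using I that by (auto simp: I_def P_def J_def Q_def)
      hence "P i (sem G (nest ?rs ?c) ?s)"
        using Pc[OF _ less_imp_le[OF that]] Pu by (rule sem_nest_invariant)
      then show ?thesis by (simp add: P_def)
    qed
    moreover have "Q (sem G (nest ?rs ?c) ?s)" if "i < w"
    proof -
      have "Q ?s" using I that by (auto simp: I_def Q_def)
      then show ?thesis using Qc Qu by (rule sem_nest_invariant)
    qed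
    moreover have "Q (sem G (nest ?rs ?c) ?s)" if "i = w"
    proof (rule sem_nest_hit[where P = "P w" and vs = "T @ U" and n = n])
      show "P w ?s" using I that by (auto simp: I_def P_def J_def Q_def)
      show "P w s \<Longrightarrow> fst s 0 = n" for s by (simp add: P_def)
      show "length (T @ U) = length ?rs" "set (T @ U) \<subseteq> {..n}"
        using T U by (auto simp: regs_props)
    qed (fact Pc[OF _ order_refl] Pu Qc Qu hit wf regs_props(5) disj)+
    ultimately show "I i (sem G (nest ?rs ?c) ?s)"
      unfolding I_def by (metis linorder_neqE_nat)
  qed simp
  then show ?thesis by (simp add: I_def Q_def)
qed

text \<open>Each of the \<open>2 * L + 1\<close> loops contributes a factor
  \<open>8 * (n + 1) \<le> n ^ 5\<close>, in total the exponent \<open>10 * L + 5\<close>; the body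
  contributes \<open>2 * L + 14\<close>.\<close>

lemma cost_clique_search:
  assumes "2 \<le> n"
  shows "cost n (clique_search L) \<le> n ^ (12 * L + 19)"
proof -
  let ?c = "try_candidate (T_regs L) (U_regs L)"
  have n5: "8 * (n + 1) \<le> n ^ 5"
  proof -
    have "8 * (n + 1) \<le> 16 * n" using assms by simp
    also have "\<dots> \<le> n ^ 4 * n" using power_mono[OF assms, of 4] by (intro mult_right_mono) auto
    finally show ?thesis by (simp add: eval_nat_numeral mult.commute)
  qed
  have "2 * L + 1 \<le> 2 ^ (2 * L)"
    using less_exp[of "2 * L"] by linarith
  also have "\<dots> \<le> n ^ (2 * L)" using assms by (rule power_mono) simp
  finally have L: "2 * L + 1 \<le> n ^ (2 * L)" .
  have "1000 \<le> (2::nat) ^ 10" by simp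
  also have "\<dots> \<le> n ^ 10" using assms by (rule power_mono) simp
  finally have K: "1000 \<le> n ^ 10" .
  have "2 * n \<le> n * n" using assms by simp
  hence "n + 1 \<le> n ^ 2" using assms unfolding power2_eq_square by linarith
  hence N: "(n + 1)\<^sup>2 \<le> n ^ 4"
    using power_mono[of "n + 1" "n ^ 2" 2] by (simp flip: power_mult)
  have "cost n ?c \<le> 1000 * (2 * L + 1) * (n + 1)\<^sup>2"
    using cost_try_candidate[of n "T_regs L" "U_regs L"] by (simp add: regs_props mult_2)
  also have "\<dots> \<le> n ^ 10 * n ^ (2 * L) * n ^ 4"
    using K L N by (intro mult_le_mono)
  finally have c: "cost n ?c \<le> n ^ (2 * L + 14)" by (simp add: power_add[symmetric] algebra_simps)
  have "cost n (clique_search L) \<le> 8 * (n + 1) * cost n (nest (T_regs L @ U_regs L) ?c)"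
    unfolding clique_search_def by (rule cost_For_le[OF cost_pos])
  also have "\<dots> \<le> 8 * (n + 1) * ((8 * (n + 1)) ^ (2 * L) * cost n ?c)"
    using cost_nest_le[of n "T_regs L @ U_regs L" ?c] by (intro mult_left_mono) (simp_all add: regs_props mult_2)
  also have "\<dots> \<le> n ^ 5 * ((n ^ 5) ^ (2 * L) * n ^ (2 * L + 14))"
    using n5 c by (intro mult_le_mono power_mono) auto
  also have "\<dots> = n ^ (12 * L + 19)"
    by (simp add: algebra_simps flip: power_mult power_add)
  finally show ?thesis .
qed

section \<open>Bicliques in the random graph\<close>

definition has_biclique :: "nat \<Rightarrow> nat \<Rightarrow> nat set set \<Rightarrow> bool" where
  "has_biclique a n G \<longleftrightarrow> (\<exists>A B. A \<subseteq> {..<n} \<and> B \<subseteq> {..<n} \<and> A \<inter> B = {} \<and> card A = a \<and> card B = a \<and>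
     (\<forall>x\<in>A. \<forall>y\<in>B. {x, y} \<in> G))"

lemma finite_pairs: "finite (pairs n)"
proof (rule finite_subset)
  show "pairs n \<subseteq> Pow {..<n}" by (auto simp: pairs_def)
qed simp

lemma pairsI:
  assumes "x < n" "y < n" "x \<noteq> y"
  shows "{x, y} \<in> pairs n"
proof -
  have "min x y < max x y" "max x y < n" "{x, y} = {min x y, max x y}"
    using assms by (auto simp: min_def max_def)
  then show ?thesis unfolding pairs_def by blast
qed

text \<open>Edges are independent, and the event is a product set in which the coordinates in
  \<open>E\<close> are forced and the others free.\<close>

lemma prob_gnp_superset:
  assumes "E \<subseteq> pairs n" "0 \<le> p" "p \<le> 1"
  shows "measure_pmf.prob (gnp n p) {G. E \<subseteq> G} = p ^ card E"
proof -
  let ?B = "\<lambda>e. if e \<in> E then {True} else UNIV"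
  have vimage: "(\<lambda>f. {e \<in> pairs n. f e}) -` {G. E \<subseteq> G} = Pi (pairs n) ?B"
    using assms(1) by (auto simp: Pi_def split: if_splits)
  have "measure_pmf.prob (gnp n p) {G. E \<subseteq> G}
      = (\<Prod>e\<in>pairs n. measure_pmf.prob (bernoulli_pmf p) (?B e))"
    unfolding gnp_def measure_map_pmf vimage by (rule measure_Pi_pmf_Pi[OF finite_pairs])
  also have "\<dots> = (\<Prod>e\<in>pairs n. if e \<in> E then p else 1)"
    using assms(2,3) by (intro prod.cong) (auto simp: measure_pmf_single)
  also have "\<dots> = (\<Prod>e\<in>E. p)"
    using assms(1) finite_pairs by (subst prod.inter_restrict[symmetric]) (auto simp: Int_absorb1)
  finally show ?thesis by simp
qed

text \<open>Union bound over at most \<open>n ^ (2 * a)\<close> ordered pairs of disjoint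
  \<open>a\<close>-sets; disjointness makes the \<open>a * a\<close> edges of a pair
  distinct.\<close>

lemma prob_has_biclique_le:
  assumes "0 \<le> p" "p \<le> 1"
  shows "measure_pmf.prob (gnp n p) {G. has_biclique a n G} \<le> real n ^ (2 * a) * p ^ (a * a)"
proof -
  define F where "F = {A. A \<subseteq> {..<n} \<and> card A = a}"
  define S where "S = {(A, B). A \<in> F \<and> B \<in> F \<and> A \<inter> B = {}}"
  define X where "X = (\<lambda>(A, B). (\<lambda>(x, y). {x, y}) ` (A \<times> B) :: nat set set)"
  have finF: "finite F" unfolding F_def by simp
  have SF: "S \<subseteq> F \<times> F" unfolding S_def by auto
  have finS: "finite S" using finite_subset[OF SF] finF by simp
  have "card F = n choose a"
    unfolding F_def using n_subsets[of "{..<n}" a] by simp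
  also have "\<dots> \<le> n ^ a"
    by (cases "a \<le> n") (simp_all add: binomial_le_pow binomial_eq_0)
  finally have cF: "card F \<le> n ^ a" .
  have "card S \<le> card (F \<times> F)"
    using SF finF by (intro card_mono) auto
  also have "\<dots> \<le> n ^ a * n ^ a"
    unfolding card_cartesian_product using cF by (intro mult_mono) auto
  finally have cS: "card S \<le> n ^ (2 * a)" by (simp add: mult_2 power_add)
  have prob: "measure_pmf.prob (gnp n p) {G. X s \<subseteq> G} = p ^ (a * a)" if sS: "s \<in> S" for s
  proof -
    obtain A B where s: "s = (A, B)" "A \<subseteq> {..<n}" "B \<subseteq> {..<n}" "card A = a" "card B = a" "A \<inter> B = {}"
      using sS unfolding S_def F_def by auto
    have "X s \<subseteq> pairs n"
      using s(2,3,6) unfolding X_def s(1) by (auto intro!: pairsI)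
    moreover have "inj_on (\<lambda>(x, y). {x, y}) (A \<times> B)"
      using s(6) by (auto simp: inj_on_def doubleton_eq_iff)
    hence "card (X s) = a * a"
      unfolding X_def s(1) by (simp add: card_image card_cartesian_product s(4,5))
    ultimately show ?thesis using prob_gnp_superset[of "X s"] assms by simp
  qed
  have "{G. has_biclique a n G} \<subseteq> (\<Union>s\<in>S. {G. X s \<subseteq> G})"
  proof
    fix G assume "G \<in> {G. has_biclique a n G}"
    then obtain A B where "A \<subseteq> {..<n}" "B \<subseteq> {..<n}" "A \<inter> B = {}" "card A = a" "card B = a"
      "\<forall>x\<in>A. \<forall>y\<in>B. {x, y} \<in> G"
      unfolding has_biclique_def by auto
    hence "(A, B) \<in> S" "X (A, B) \<subseteq> G"
      unfolding S_def F_def X_def by auto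
    then show "G \<in> (\<Union>s\<in>S. {G. X s \<subseteq> G})" by blast
  qed
  hence "measure_pmf.prob (gnp n p) {G. has_biclique a n G}
      \<le> measure_pmf.prob (gnp n p) (\<Union>s\<in>S. {G. X s \<subseteq> G})"
    by (intro measure_pmf.finite_measure_mono) auto
  also have "\<dots> \<le> (\<Sum>s\<in>S. measure_pmf.prob (gnp n p) {G. X s \<subseteq> G})"
    using finS by (intro measure_pmf.finite_measure_subadditive_finite) auto
  also have "\<dots> = real (card S) * p ^ (a * a)"
    using prob by simp
  also have "\<dots> \<le> real n ^ (2 * a) * p ^ (a * a)"
  proof (rule mult_right_mono)
    show "real (card S) \<le> real n ^ (2 * a)"
      using cS by (metis of_nat_le_iff of_nat_power)
  qed (use assms in simp)
  finally show ?thesis .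
qed

text \<open>For \<open>n > 0\<close> the expression is \<open>n powr (- c)\<close> with
  \<open>c = a * (a * (1 - \<delta>) - 2)\<close>, and the assumption on \<open>a\<close> makes
  \<open>c\<close> positive.\<close>

lemma biclique_bound_tendsto_0:
  assumes "\<delta> < 1" "2 / (1 - \<delta>) < real a"
  shows "(\<lambda>n. real n ^ (2 * a) * (real n powr (\<delta> - 1)) ^ (a * a)) \<longlonglongrightarrow> 0"
proof -
  define c where "c = real a * (real a * (1 - \<delta>) - 2)"
  have "0 < 2 / (1 - \<delta>)" using assms(1) by simp
  hence "0 < real a" using assms(2) by linarith
  moreover have "2 < real a * (1 - \<delta>)"
    using assms by (simp add: field_simps)
  ultimately have "0 < c" by (simp add: c_def)
  hence "(\<lambda>n. real n powr (- c)) \<longlonglongrightarrow> 0"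
    by (intro tendsto_neg_powr filterlim_real_sequentially) auto
  moreover have "\<forall>\<^sub>F n in sequentially.
      real n powr (- c) = real n ^ (2 * a) * (real n powr (\<delta> - 1)) ^ (a * a)"
    using eventually_gt_at_top[of 0]
  proof eventually_elim
    case (elim n)
    have "real n ^ (2 * a) * (real n powr (\<delta> - 1)) ^ (a * a)
        = real n powr (2 * real a) * real n powr ((\<delta> - 1) * (real a * real a))"
      using elim by (simp add: powr_realpow[symmetric] powr_powr)
    also have "\<dots> = real n powr (- c)"
      by (simp add: powr_add[symmetric] c_def algebra_simps)
    finally show ?case by simp
  qed
  ultimately show ?thesis by (rule Lim_transform_eventually)
qed

lemma set_pmf_gnp: "G \<in> set_pmf (gnp n p) \<Longrightarrow> G \<subseteq> pairs n"
  unfolding gnp_def by auto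

text \<open>For \<open>n \<ge> 2\<close>, \<open>E n\<close> contains all biclique-free graphs in
  the support of \<open>gnp\<close>, so its probability is squeezed between 1 minus the union bound
  and 1.\<close>

lemma prob_no_biclique_tendsto_1:
  assumes "0 < \<delta>" "\<delta> < 1" "2 / (1 - \<delta>) < real a"
    and good: "\<And>n G. 2 \<le> n \<Longrightarrow> G \<subseteq> pairs n \<Longrightarrow> \<not> has_biclique a n G \<Longrightarrow> G \<in> E n"
  shows "(\<lambda>n. measure_pmf.prob (gnp n (real n powr (\<delta> - 1))) (E n)) \<longlonglongrightarrow> 1"
proof (rule tendsto_sandwich)
  let ?p = "\<lambda>n. real n powr (\<delta> - 1)"
  show "(\<lambda>n. 1 - real n ^ (2 * a) * ?p n ^ (a * a)) \<longlonglongrightarrow> 1"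
    using tendsto_diff[OF tendsto_const[of "1::real"] biclique_bound_tendsto_0[OF assms(2,3)]] by simp
  show "(\<lambda>n. 1) \<longlonglongrightarrow> (1::real)" by simp
  show "\<forall>\<^sub>F n in sequentially. measure_pmf.prob (gnp n (?p n)) (E n) \<le> 1"
    by simp
  show "\<forall>\<^sub>F n in sequentially. 1 - real n ^ (2 * a) * ?p n ^ (a * a) \<le> measure_pmf.prob (gnp n (?p n)) (E n)"
    using eventually_ge_at_top[of 2]
  proof eventually_elim
    case (elim n)
    have "?p n \<le> real n powr 0"
      using elim assms(2) by (intro powr_mono) auto
    hence p: "0 \<le> ?p n" "?p n \<le> 1" using elim by auto
    have "1 - real n ^ (2 * a) * ?p n ^ (a * a) \<le> 1 - measure_pmf.prob (gnp n (?p n)) {G. has_biclique a n G}"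
      using prob_has_biclique_le[OF p, of n a] by simp
    also have "\<dots> = measure_pmf.prob (gnp n (?p n)) (- {G. has_biclique a n G})"
      using measure_pmf.prob_compl[of "{G. has_biclique a n G}" "gnp n (?p n)"]
      by (simp add: Compl_eq_Diff_UNIV)
    also have "\<dots> \<le> measure_pmf.prob (gnp n (?p n)) (E n)"
      using good[OF elim] set_pmf_gnp
      by (intro measure_pmf.finite_measure_mono_AE) (auto simp: AE_measure_pmf_iff)
    finally show ?case .
  qed
qed

section \<open>Maximum cliques of the planted graph\<close>

text \<open>Search tuples have a fixed length; the filler \<open>d\<close> makes up for smaller
  sets, including the empty one.\<close>

lemma ex_padded_list:
  assumes "finite A" "card A \<le> L"
  shows "\<exists>xs. length xs = L \<and> A \<subseteq> set xs \<and> set xs \<subseteq> insert d A"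
proof -
  obtain ys where ys: "set ys = A" "length ys = card A"
    using assms(1) by (metis distinct_card finite_distinct_list)
  then show ?thesis using assms(2)
    by (intro exI[of _ "ys @ replicate (L - card A) d"]) auto
qed

text \<open>Any two disjoint \<open>a\<close>-subsets of a clique are the sides of a
  biclique.\<close>

lemma has_biclique_if_clique:
  assumes "finite C" "2 * a \<le> card C" "C \<subseteq> {..<n}" "\<And>x y. x \<in> C \<Longrightarrow> y \<in> C \<Longrightarrow> x \<noteq> y \<Longrightarrow> {x, y} \<in> G"
  shows "has_biclique a n G"
proof -
  obtain A where A: "A \<subseteq> C" "card A = a" "finite A"
    using obtain_subset_with_card_n[of a C] assms(2) by auto
  have "a \<le> card (C - A)" using A assms(1,2) by (simp add: card_Diff_subset)
  then obtain B where B: "B \<subseteq> C - A" "card B = a"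
    using obtain_subset_with_card_n by metis
  have "A \<subseteq> {..<n}" "B \<subseteq> {..<n}" "A \<inter> B = {}"
    using A(1) B(1) assms(3) by auto
  moreover have "\<forall>x\<in>A. \<forall>y\<in>B. {x, y} \<in> G"
    using A(1) B(1) by (intro ballI assms(4)) auto
  ultimately show ?thesis
    using A(2) B(2) unfolding has_biclique_def by blast
qed

text \<open>A candidate entry \<open>n\<close> in the second tuple excludes no vertex and serves as padding.\<close>
lemma max_clique_is_candidate:
  assumes G': "G' \<subseteq> pairs n" "\<not> has_biclique a n G'" and K: "K \<subseteq> {..<n}"
    and D: "is_max_clique n (plant n G' K) D" and "0 < n" "0 < a"
  shows "\<exists>T U. length T = 3 * a \<and> length U = 3 * a \<and> set T \<subseteq> {..n} \<and> set U \<subseteq> {..n} \<and>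
    D = candidate n (plant n G' K) T U"
proof -
  define G where "G = plant n G' K"
  have edge: "{x, y} \<in> G \<Longrightarrow> {x, y} \<in> G' \<or> (x \<in> K \<and> y \<in> K)" for x y
    by (auto simp: G_def plant_def)
  have clD: "is_clique n G D" and maxD: "is_clique n G C \<Longrightarrow> card C \<le> card D" for C
    using D by (auto simp: is_max_clique_def G_def)
  have Dn: "D \<subseteq> {..<n}" and De: "x \<in> D \<Longrightarrow> y \<in> D \<Longrightarrow> x \<noteq> y \<Longrightarrow> {x, y} \<in> G" for x y
    using clD by (auto simp: is_clique_def)
  have fin: "finite D" "finite K"
    using Dn K finite_subset by blast+
  have clK: "is_clique n G K"
    using K by (auto simp: is_clique_def G_def plant_def intro!: pairsI)
  \<comment> \<open>\<open>T\<close> lists \<open>A\<close>, padded by an element of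
    \<open>A\<close>; \<open>U\<close> lists what the common closed neighbourhood has beyond
    \<open>D\<close>, padded by \<open>n\<close>.\<close>
  have main: "\<exists>T U. length T = 3 * a \<and> length U = 3 * a \<and> set T \<subseteq> {..n} \<and> set U \<subseteq> {..n} \<and>
      D = candidate n G T U"
    if A: "A \<subseteq> D" "A \<noteq> {}" "card A \<le> 3 * a"
      and M: "card ({v. v < n \<and> (\<forall>t\<in>A. v = t \<or> {v, t} \<in> G)} - D) \<le> 3 * a" for A
  proof -
    let ?M = "{v. v < n \<and> (\<forall>t\<in>A. v = t \<or> {v, t} \<in> G)}"
    have finA: "finite A" using A(1) fin(1) finite_subset by blast
    obtain t where t: "t \<in> A" using A(2) by blast
    obtain T where T: "length T = 3 * a" "set T = A"
      using ex_padded_list[OF finA A(3), of t] t by auto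
    obtain U where U: "length U = 3 * a" "?M - D \<subseteq> set U" "set U \<subseteq> insert n (?M - D)"
      using ex_padded_list[OF _ M, of n] by auto
    have "D \<subseteq> ?M"
      using Dn De A(1) by blast
    hence "D = candidate n G T U"
      unfolding candidate_def T(2) using U Dn by auto
    moreover have "set T \<subseteq> {..n}" "set U \<subseteq> {..n}"
      using T(2) A(1) Dn U(3) by (auto simp: subset_iff)
    ultimately show ?thesis using T(1) U(1) by blast
  qed
  show ?thesis
  proof (cases "card D \<le> 3 * a")
    case True
    have "is_clique n G {0}" using \<open>0 < n\<close> by (auto simp: is_clique_def)
    hence "D \<noteq> {}" using maxD[of "{0}"] by auto
    \<comment> \<open>A small clique describes itself: by maximality no further vertex is adjacent
      to all of it, so there are no exceptions to list.\<close>
    have "v \<in> D" if "v < n" "\<forall>t\<in>D. v = t \<or> {v, t} \<in> G" for v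
    proof (rule ccontr)
      assume "v \<notin> D"
      have "is_clique n G (insert v D)"
        using that Dn De by (auto simp: is_clique_def insert_commute)
      with maxD[of "insert v D"] \<open>v \<notin> D\<close> fin show False by simp
    qed
    hence M: "{v. v < n \<and> (\<forall>t\<in>D. v = t \<or> {v, t} \<in> G)} - D = {}" by auto
    show ?thesis
      unfolding G_def[symmetric] by (rule main[OF subset_refl \<open>D \<noteq> {}\<close> True]) (simp only: M card.empty)
  next
    case False
    \<comment> \<open>Edges within \<open>D - K\<close> come from \<open>G'\<close>, so
      \<open>2 * a\<close> vertices there would yield a biclique of \<open>G'\<close>.\<close>
    have "card (D - K) < 2 * a"
    proof (rule ccontr)
      assume "\<not> card (D - K) < 2 * a"
      hence "has_biclique a n G'"
        using fin Dn De edge by (intro has_biclique_if_clique[of "D - K"]) fastforce+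
      with G'(2) show False by simp
    qed
    moreover have "card D = card (D \<inter> K) + card (D - K)"
      using fin by (metis card_Int_Diff)
    ultimately have "a \<le> card (D \<inter> K)" using False by linarith
    then obtain A where A: "A \<subseteq> D \<inter> K" "card A = a" "finite A"
      using obtain_subset_with_card_n by metis
    define M where "M = {v. v < n \<and> (\<forall>t\<in>A. v = t \<or> {v, t} \<in> G)}"
    have finM: "finite M" by (simp add: M_def)
    have KM: "K \<subseteq> M" using K clK A(1) unfolding M_def is_clique_def by blast
    have DM: "D \<subseteq> M" using Dn De A(1) unfolding M_def by blast
    have "card (M - K) < a"
    proof (rule ccontr)
      assume "\<not> card (M - K) < a"
      then obtain B where B: "B \<subseteq> M - K" "card B = a"
        using obtain_subset_with_card_n[of a "M - K"] by auto
      \<comment> \<open>A planted edge has both ends in \<open>K\<close>, whereas \<open>y\<close>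
        lies outside; so this edge is from \<open>G'\<close>.\<close>
      have "{x, y} \<in> G'" if "x \<in> A" "y \<in> B" for x y
      proof -
        have "y \<notin> K" "x \<in> K" using that A(1) B(1) by auto
        moreover have "y = x \<or> {y, x} \<in> G" using that B(1) unfolding M_def by blast
        ultimately show ?thesis using edge[of y x] by (auto simp: insert_commute)
      qed
      moreover have "A \<subseteq> {..<n}" "B \<subseteq> {..<n}" "A \<inter> B = {}"
        using A(1) B(1) Dn by (auto simp: M_def)
      ultimately have "has_biclique a n G'"
        using A(2) B(2) unfolding has_biclique_def by blast
      with G'(2) show False by simp
    qed
    \<comment> \<open>\<open>D\<close> and \<open>K\<close> are both subsets of \<open>M\<close>,
      and \<open>card K \<le> card D\<close> because \<open>K\<close> is a clique of the planted
      graph.\<close>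
    moreover have "card (M - D) \<le> card (M - K)"
      using fin finM KM DM maxD[OF clK] by (simp add: card_Diff_subset)
    ultimately have "card (M - D) \<le> 3 * a" by linarith
    moreover have "A \<noteq> {}" using A(2) \<open>0 < a\<close> by auto
    ultimately show ?thesis
      unfolding G_def[symmetric] using A main[of A] by (simp add: M_def)
  qed
qed

section \<open>Existence of maximum cliques, choice of constants and conclusion\<close>

lemma ex_max_clique: "\<exists>D. is_max_clique n G D"
proof -
  have "card C < n + 1" if "is_clique n G C" for C
    using that card_mono[of "{..<n}" C] by (auto simp: is_clique_def)
  moreover have "is_clique n G {}" by (simp add: is_clique_def)
  ultimately show ?thesis
    using ex_has_greatest_nat[of "is_clique n G" "{}" card "n + 1"] by (auto simp: is_max_clique_def)
qed

text \<open>Source of 127: \<open>36 * a + 19\<close> is at most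
  \<open>(108 + 19) / (1 - \<delta>)\<close>, by \<open>a \<le> 3 / (1 - \<delta>)\<close> and
  \<open>1 \<le> 1 / (1 - \<delta>)\<close>.\<close>

lemma clique_search_time:
  assumes "0 < \<delta>" "\<delta> < 1" "real a \<le> 3 / (1 - \<delta>)" "2 \<le> n"
  shows "real (n ^ (12 * (3 * a) + 19)) \<le> 127 * real n powr (127 / (1 - \<delta>))"
proof -
  have "1 \<le> 1 / (1 - \<delta>)" using assms(1,2) by simp
  hence "real (12 * (3 * a) + 19) \<le> 127 / (1 - \<delta>)"
    using assms(3) by (simp add: field_simps)
  hence "real n powr real (12 * (3 * a) + 19) \<le> real n powr (127 / (1 - \<delta>))"
    using assms(4) by (intro powr_mono) auto
  moreover have "real (n ^ (12 * (3 * a) + 19)) = real n powr real (12 * (3 * a) + 19)"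
    using assms(4) by (subst powr_realpow) auto
  moreover have "0 \<le> real n powr (127 / (1 - \<delta>))" by simp
  ultimately show ?thesis by linarith
qed

theorem theorem1p2:
  "\<exists>C::real. C > 0 \<and>
     (\<forall>\<delta>::real. 0 < \<delta> \<and> \<delta> < 1 \<longrightarrow>
       (\<forall>k::nat \<Rightarrow> nat. (\<forall>n. k n \<le> n) \<longrightarrow>
         (\<exists>prog::instr list.
            (\<forall>n\<ge>2. \<forall>G. G \<subseteq> pairs n \<longrightarrow>
               (\<exists>t. real t \<le> C * real n powr (C / (1 - \<delta>)) \<and>
                    halts_within prog G (init_config n (k n)) t)) \<and>
            (\<forall>S. strategy k S \<longrightarrow>
               (\<lambda>n. measure_pmf.prob (gnp n (real n powr (\<delta> - 1)))
                      {G'. \<exists>K. ram_output prog (plant n G' (S n G')) (init_config n (k n)) = Some K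
                              \<and> is_max_clique n (plant n G' (S n G')) K})
               \<longlonglongrightarrow> 1))))"
proof (rule exI[of _ 127], intro conjI allI impI)
  fix \<delta> :: real and k :: "nat \<Rightarrow> nat"
  assume \<delta>: "0 < \<delta> \<and> \<delta> < 1"
  \<comment> \<open>The added 1 makes \<open>2 / (1 - \<delta>) < a\<close> strict and costs at most
    \<open>1 / (1 - \<delta>)\<close>, which gives the bound
    \<open>3 / (1 - \<delta>)\<close>.\<close>
  define a where "a = nat \<lfloor>2 / (1 - \<delta>)\<rfloor> + 1"
  have "0 < 2 / (1 - \<delta>)" "1 < 1 / (1 - \<delta>)" using \<delta> by auto
  hence a: "2 / (1 - \<delta>) < real a" "real a \<le> 3 / (1 - \<delta>)" "0 < a"
    unfolding a_def using of_int_floor_le[of "2 / (1 - \<delta>)"] by (simp_all, linarith+)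
  \<comment> \<open>The program depends on \<open>\<delta>\<close> only and serves every
    \<open>k\<close> and every strategy; \<open>3 * a\<close> is the tuple length from
    \<open>max_clique_is_candidate\<close>.\<close>
  let ?c = "clique_search (3 * a)"
  show "\<exists>prog. (\<forall>n\<ge>2. \<forall>G. G \<subseteq> pairs n \<longrightarrow>
               (\<exists>t. real t \<le> 127 * real n powr (127 / (1 - \<delta>)) \<and>
                    halts_within prog G (init_config n (k n)) t)) \<and>
            (\<forall>S. strategy k S \<longrightarrow>
               (\<lambda>n. measure_pmf.prob (gnp n (real n powr (\<delta> - 1)))
                      {G'. \<exists>K. ram_output prog (plant n G' (S n G')) (init_config n (k n)) = Some K
                              \<and> is_max_clique n (plant n G' (S n G')) K})
               \<longlonglongrightarrow> 1)"
  proof (intro exI[of _ "compile 0 ?c"] conjI allI impI)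
    fix n :: nat and G :: "nat set set" assume n: "2 \<le> n"
    obtain t where t: "t \<le> cost n ?c" "halts_within (compile 0 ?c) G (init_config n (k n)) t"
      using compile_correct(1)[OF wf_clique_search] by blast
    have "t \<le> n ^ (12 * (3 * a) + 19)"
      using t(1) cost_clique_search[OF n] by (rule le_trans)
    hence "real t \<le> real (n ^ (12 * (3 * a) + 19))" by (rule of_nat_mono)
    also have "\<dots> \<le> 127 * real n powr (127 / (1 - \<delta>))"
      using \<delta> a n by (intro clique_search_time) auto
    finally show "\<exists>t. real t \<le> 127 * real n powr (127 / (1 - \<delta>)) \<and>
        halts_within (compile 0 ?c) G (init_config n (k n)) t"
      using t(2) by blast
  next
    fix S assume S: "strategy k S"
    show "(\<lambda>n. measure_pmf.prob (gnp n (real n powr (\<delta> - 1)))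
        {G'. \<exists>K. ram_output (compile 0 ?c) (plant n G' (S n G')) (init_config n (k n)) = Some K
             \<and> is_max_clique n (plant n G' (S n G')) K}) \<longlonglongrightarrow> 1"
    proof (rule prob_no_biclique_tendsto_1[OF _ _ a(1)])
      \<comment> \<open>Without a biclique in \<open>G'\<close> the search succeeds whatever set the
        strategy picks; randomness enters only through the absence of bicliques.\<close>
      fix n :: nat and G' :: "nat set set" assume n: "2 \<le> n" and G': "G' \<subseteq> pairs n" "\<not> has_biclique a n G'"
      let ?G = "plant n G' (S n G')"
      have SK: "S n G' \<subseteq> {..<n}" using S G'(1) by (simp add: strategy_def)
      obtain D where D: "is_max_clique n ?G D" using ex_max_clique by blast
      obtain T U where TU: "length T = 3 * a" "length U = 3 * a" "set T \<subseteq> {..n}" "set U \<subseteq> {..n}"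
        "D = candidate n ?G T U"
        using max_clique_is_candidate[OF G' SK D] n a(3) by auto
      have "is_max_clique n ?G (snd (sem ?G ?c ((\<lambda>_. 0)(0 := n, 1 := k n), {})))"
        using D TU by (intro sem_clique_search[of n ?G T U]) auto
      then show "G' \<in> {G'. \<exists>K. ram_output (compile 0 ?c) (plant n G' (S n G')) (init_config n (k n))
          = Some K \<and> is_max_clique n (plant n G' (S n G')) K}"
        using compile_correct(2)[OF wf_clique_search, of "3 * a" ?G n "k n"] by auto
    qed (use \<delta> in auto)
  qed
qed simp

end
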